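(* Let $C$ be a nonempty closed convex subset of a Hilbert space $H$ and let $\mathcal{S}=\{T_s:s\in S\}$ be a representation of a semitopological semigroup $S$ on $C$ by nonexpansive self-mappings. Suppose that $\{T_sc:s\in S\}$ is bounded for some $c\in C$. Then $\mathcal{S}$ has a common fixed point in $C$ if any of the following holds: (1) $C_b(S)$ has a left invariant mean and the map $s\mapsto T_sc$ is continuous from $S$ into $(C,\mathrm{wk})$; (2) $S$ is left amenable and the action of $S$ on $C$ is weakly jointly continuous; (3) $AP(S)$ has a left invariant mean and the action of $S$ on $C$ is weakly separately continuous and weakly equicontinuous; (4) $WAP(S)$ has a left invariant mean and the action of $S$ on $C$ is weakly separately continuous and weakly quasi-equicontinuous.
   Context: A semitopological semigroup is a semigroup with a Hausdorff topology in which $s\mapsto ts$ and $s\mapsto st$ are continuous for each $t$. A representation is a family $T_s:C\to C$ with $T_{st}=T_s\circ T_t$; nonexpansive means $\|T_sx-T_sy\|\le\|x-y\|$. $C_b(S)$: bounded continuous complex functions on $S$; $(\ell_sf)(t)=f(st)$. $LUC(S)$: those $f\in C_b(S)$ with $s\mapsto\ell_sf$ norm continuous $S\to C_b(S)$. $AP(S)$ (resp. $WAP(S)$): those $f\in C_b(S)$ whose left orbit $\{\ell_sf\}$ is relatively norm compact (resp. relatively weakly compact) in $C_b(S)$. A left invariant mean on such a space $X$ is $m\in X^*$ with $\|m\|=m(1)=1$ and $m(\ell_sf)=m(f)$. $S$ is left amenable if $LUC(S)$ has a left invariant mean. "Weakly" refers to the weak topology of $H$: weakly jointly (separately) continuous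 means $(s,x)\mapsto T_sx$ is jointly (separately) continuous $S\times(C,\mathrm{wk})\to(C,\mathrm{wk})$; weakly equicontinuous means $\{T_s\}$ is equicontinuous for the weak uniformity on $C$; weakly quasi-equicontinuous means every pointwise weak limit of a net $(T_{s_i})$ is weak-weak continuous. A common fixed point is $x\in C$ with $T_sx=x$ for all $s$. *)

theory Defs
  imports "HOL-Analysis.Analysis"
begin

text \<open>The weak topology: the coarsest topology making every continuous (real-)linear
  functional continuous. For a complex space this coincides with the usual weak topology,
  since complex functionals are determined by their real parts.\<close>
definition weak_top :: "'v::real_normed_vector topology" where
  "weak_top = topology_generated_by
     {(\<phi> -` U) | (\<phi> :: 'v \<Rightarrow> real) U. bounded_linear \<phi> \<and> open U}"

definition lshift :: "'s::semigroup_mult \<Rightarrow> ('s \<Rightarrow> complex) \<Rightarrow> ('s \<Rightarrow> complex)" where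
  "lshift s f = (\<lambda>t. f (s * t))"

definition Cb :: "('s::topological_space \<Rightarrow> complex) set" where
  "Cb = {f. continuous_on UNIV f \<and> bounded (range f)}"

definition sup_norm :: "('s::topological_space \<Rightarrow> complex) \<Rightarrow> real" where
  "sup_norm f = norm (Bcontfun f)"

definition LUC :: "('s::{topological_space,semigroup_mult} \<Rightarrow> complex) set" where
  "LUC = {f \<in> Cb. continuous_on UNIV (\<lambda>s. Bcontfun (lshift s f))}"

definition AP :: "('s::{topological_space,semigroup_mult} \<Rightarrow> complex) set" where
  "AP = {f \<in> Cb. compact (closure ((\<lambda>s. Bcontfun (lshift s f)) ` UNIV))}"

definition WAP :: "('s::{topological_space,semigroup_mult} \<Rightarrow> complex) set" where
  "WAP = {f \<in> Cb. compactin weak_top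
            (weak_top closure_of ((\<lambda>s. Bcontfun (lshift s f)) ` UNIV))}"

text \<open>A mean on a subspace X of C_b(S): a (complex-)linear functional m on X with
  norm 1 and m(1) = 1. Given m(1) = 1, the norm condition is |m f| \<le> \<parallel>f\<parallel> on X.\<close>
definition mean_on :: "('s::topological_space \<Rightarrow> complex) set \<Rightarrow> (('s \<Rightarrow> complex) \<Rightarrow> complex) \<Rightarrow> bool" where
  "mean_on X m \<longleftrightarrow>
     (\<forall>f\<in>X. \<forall>g\<in>X. m (\<lambda>t. f t + g t) = m f + m g) \<and>
     (\<forall>c. \<forall>f\<in>X. m (\<lambda>t. c * f t) = c * m f) \<and>
     (\<forall>f\<in>X. cmod (m f) \<le> sup_norm f) \<and>
     m (\<lambda>_. 1) = 1"

definition left_invariant_mean_on ::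
  "('s::{topological_space,semigroup_mult} \<Rightarrow> complex) set \<Rightarrow> (('s \<Rightarrow> complex) \<Rightarrow> complex) \<Rightarrow> bool" where
  "left_invariant_mean_on X m \<longleftrightarrow> mean_on X m \<and> (\<forall>s. \<forall>f\<in>X. m (lshift s f) = m f)"

definition has_LIM :: "('s::{topological_space,semigroup_mult} \<Rightarrow> complex) set \<Rightarrow> bool" where
  "has_LIM X \<longleftrightarrow> (\<exists>m. left_invariant_mean_on X m)"

definition left_amenable :: "'s::{topological_space,semigroup_mult} itself \<Rightarrow> bool" where
  "left_amenable _ \<longleftrightarrow> has_LIM (LUC :: ('s \<Rightarrow> complex) set)"

definition representation_on :: "'a set \<Rightarrow> ('s::semigroup_mult \<Rightarrow> 'a \<Rightarrow> 'a) \<Rightarrow> bool" where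
  "representation_on C T \<longleftrightarrow> (\<forall>s. T s ` C \<subseteq> C) \<and> (\<forall>s t. \<forall>x\<in>C. T (s * t) x = T s (T t x))"

definition nonexpansive_on :: "'a::metric_space set \<Rightarrow> ('s \<Rightarrow> 'a \<Rightarrow> 'a) \<Rightarrow> bool" where
  "nonexpansive_on C T \<longleftrightarrow> (\<forall>s. \<forall>x\<in>C. \<forall>y\<in>C. dist (T s x) (T s y) \<le> dist x y)"

definition weakly_jointly_continuous ::
  "'a::real_normed_vector set \<Rightarrow> ('s::topological_space \<Rightarrow> 'a \<Rightarrow> 'a) \<Rightarrow> bool" where
  "weakly_jointly_continuous C T \<longleftrightarrow>
     continuous_map (prod_topology euclidean (subtopology weak_top C)) (subtopology weak_top C)
       (\<lambda>(s, x). T s x)"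

definition weakly_separately_continuous ::
  "'a::real_normed_vector set \<Rightarrow> ('s::topological_space \<Rightarrow> 'a \<Rightarrow> 'a) \<Rightarrow> bool" where
  "weakly_separately_continuous C T \<longleftrightarrow>
     (\<forall>s. continuous_map (subtopology weak_top C) (subtopology weak_top C) (T s)) \<and>
     (\<forall>x\<in>C. continuous_map euclidean (subtopology weak_top C) (\<lambda>s. T s x))"

text \<open>Equicontinuity of the family T_s at every point of (C, wk), with respect to the
  weak uniformity on C (generated by the pseudometrics |phi(x) - phi(y)|, phi in H*).\<close>
definition weakly_equicontinuous ::
  "'a::real_normed_vector set \<Rightarrow> ('s \<Rightarrow> 'a \<Rightarrow> 'a) \<Rightarrow> bool" where
  "weakly_equicontinuous C T \<longleftrightarrow>
     (\<forall>x\<in>C. \<forall>\<phi> :: 'a \<Rightarrow> real. bounded_linear \<phi> \<longrightarrow> (\<forall>\<epsilon>>0.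
        \<exists>U. openin (subtopology weak_top C) U \<and> x \<in> U \<and>
            (\<forall>y\<in>U. \<forall>s. \<bar>\<phi> (T s y) - \<phi> (T s x)\<bar> < \<epsilon>)))"

text \<open>Every pointwise weak limit g of a net (T_{s_i}) is weak-weak continuous. A net
  (s_i) is represented by the (proper) filter on S it induces.\<close>
definition weakly_quasi_equicontinuous ::
  "'a::real_normed_vector set \<Rightarrow> ('s \<Rightarrow> 'a \<Rightarrow> 'a) \<Rightarrow> bool" where
  "weakly_quasi_equicontinuous C T \<longleftrightarrow>
     (\<forall>g F. F \<noteq> bot \<and> (\<forall>x\<in>C. limitin weak_top (\<lambda>s. T s x) (g x) F) \<longrightarrow>
        continuous_map (subtopology weak_top C) weak_top g)"

end

theory Submission
  imports Defs
begin

text \<open>A left invariant mean \<open>m\<close> on a space containing the functions \<open>s \<mapsto> \<langle>T s c, y\<rangle>\<close> has a barycentre \<open>p \<in> C\<close>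
  with \<open>\<langle>p, y\<rangle> = m(\<langle>T s c, y\<rangle>)\<close>. If the lower integral \<open>m\<^sub>*\<close> of \<open>m\<close> is used for \<open>\<parallel>T s c - x\<parallel>\<^sup>2\<close>, then
  \<open>m\<^sub>*(\<parallel>T s c - x\<parallel>\<^sup>2) = m\<^sub>*(\<parallel>T s c - p\<parallel>\<^sup>2) + \<parallel>p - x\<parallel>\<^sup>2\<close>, while invariance and nonexpansiveness give
  \<open>m\<^sub>*(\<parallel>T s c - T t p\<parallel>\<^sup>2) \<le> m\<^sub>*(\<parallel>T s c - p\<parallel>\<^sup>2)\<close>; hence \<open>T t p = p\<close>. No continuity of the norm along the
  orbit is needed, so it remains to see that \<open>s \<mapsto> f (T s c)\<close> belongs to \<open>LUC\<close>, \<open>AP\<close> or \<open>WAP\<close> for weakly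
  continuous \<open>f\<close>. The orbit lies in a weakly compact set \<open>K\<close>; compactness turns joint continuity and
  equicontinuity into uniform convergence on \<open>K\<close>. For \<open>WAP\<close>, quasi-equicontinuity makes all pointwise
  limits of \<open>f \<circ> T s\<close> continuous on \<open>K\<close>, and Grothendieck's theorem on pointwise compact subsets of
  \<open>C(K)\<close> applies.\<close>

section \<open>Ultrafilters and compactness\<close>

text \<open>Ultrafilters are taken as filters, so that limits along them replace limits of subnets;
  \<open>U \<le> F\<close> means that \<open>U\<close> refines \<open>F\<close>.\<close>

definition ultra :: "'a filter \<Rightarrow> bool" where
  "ultra U \<longleftrightarrow> U \<noteq> bot \<and> (\<forall>P. eventually P U \<or> eventually (\<lambda>x. \<not> P x) U)"

lemma ultra_not_bot: "ultra U \<Longrightarrow> U \<noteq> bot"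
  by (simp add: ultra_def)

lemma ultraD: "ultra U \<Longrightarrow> \<not> eventually P U \<Longrightarrow> eventually (\<lambda>x. \<not> P x) U"
  by (auto simp: ultra_def)

lemma ultra_filtermap: "ultra U \<Longrightarrow> ultra (filtermap f U)"
  by (auto simp: ultra_def filtermap_bot_iff eventually_filtermap)

text \<open>Zorn's lemma for the proper filters below \<open>F\<close> in reversed order: the
  infimum of a nonempty chain is proper, since what holds eventually for it holds eventually for
  some member.\<close>

lemma ex_ultra_le:
  assumes "F \<noteq> bot"
  obtains U where "ultra U" "U \<le> F"
proof -
  define A where "A = {G. G \<noteq> bot \<and> G \<le> F}"
  have "\<exists>m\<in>A. \<forall>a\<in>A. a \<le> m \<longrightarrow> a = m"
  proof (rule predicate_Zorn)
    show "partial_order_on A (relation_of (\<lambda>x y. y \<le> x) A)"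
      by (rule partial_order_on_relation_ofI) auto
  next
    fix C assume C: "C \<in> Chains (relation_of (\<lambda>x y. y \<le> x) A)"
    show "\<exists>u\<in>A. \<forall>a\<in>C. u \<le> a"
    proof (cases "C = {}")
      case True
      then show ?thesis using assms by (auto simp: A_def)
    next
      case False
      have CA: "C \<subseteq> A" using C by (auto simp: Chains_def relation_of_def)
      have "\<exists>x\<in>C. x \<le> inf G H" if "G \<in> C" "H \<in> C" for G H
      proof -
        have "G \<le> H \<or> H \<le> G"
          using C that by (auto simp: Chains_def relation_of_def)
        then show ?thesis using that by auto
      qed
      then have "eventually P (Inf C) \<longleftrightarrow> (\<exists>b\<in>C. eventually P b)" for P
        using eventually_Inf_base[OF False] by blast
      then have "Inf C \<noteq> bot"
        using CA by (auto simp: A_def trivial_limit_def)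
      moreover have "Inf C \<le> F"
      proof -
        obtain G where "G \<in> C" "G \<le> F" using False CA by (auto simp: A_def)
        then show ?thesis by (rule Inf_lower2)
      qed
      ultimately show ?thesis
        by (auto simp: A_def intro!: bexI[of _ "Inf C"] Inf_lower)
    qed
  qed
  then obtain U where U: "U \<in> A" "\<And>G. G \<in> A \<Longrightarrow> G \<le> U \<Longrightarrow> G = U" by blast
  have "ultra U"
    unfolding ultra_def
  proof (intro conjI allI)
    show "U \<noteq> bot" using U by (simp add: A_def)
    fix P
    show "eventually P U \<or> eventually (\<lambda>x. \<not> P x) U"
    proof (rule disjCI)
      assume neg: "\<not> eventually (\<lambda>x. \<not> P x) U"
      \<comment> \<open>Adjoining \<open>{x. P x}\<close> to \<open>U\<close> gives a proper filter,
        which minimality makes equal to \<open>U\<close>.\<close>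
      let ?G = "inf U (principal {x. P x})"
      have "?G \<noteq> bot"
        using neg by (simp add: trivial_limit_def eventually_inf_principal)
      then have "?G \<in> A"
        using U(1) by (auto simp: A_def intro: le_infI1)
      then have "?G = U"
        using U(2) by simp
      then show "eventually P U"
        using eventually_inf_principal[of P U "{x. P x}"] by simp
    qed
  qed
  moreover have "U \<le> F" using U by (simp add: A_def)
  ultimately show thesis by (rule that)
qed

text \<open>Used to refute convergence: the bad event holds along one ultrafilter, along which all
  other limits can then be taken.\<close>

lemma frequently_ultra:
  assumes "frequently P F"
  obtains U where "ultra U" "U \<le> F" "eventually P U"
proof -
  have "inf F (principal {x. P x}) \<noteq> bot"
    using assms by (simp add: trivial_limit_def eventually_inf_principal frequently_def)
  then obtain U where U: "ultra U" "U \<le> inf F (principal {x. P x})"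
    by (rule ex_ultra_le)
  then have "eventually P U"
    by (auto simp: le_principal)
  with U that show thesis by auto
qed

text \<open>When no finite subfamily covers \<open>A\<close>, the sets \<open>A - u\<close> have the
  finite intersection property.\<close>

lemma no_finite_subcover_ultra:
  assumes "\<And>\<F>. finite \<F> \<Longrightarrow> \<F> \<subseteq> \<U> \<Longrightarrow> \<not> A \<subseteq> \<Union>\<F>"
  obtains U where "ultra U" "\<And>u. u \<in> \<U> \<Longrightarrow> eventually (\<lambda>x. x \<in> A \<and> x \<notin> u) U"
proof -
  have "(INF u\<in>\<U>. principal (A - u)) \<noteq> bot"
  proof (rule INF_filter_not_bot)
    fix X assume X: "X \<subseteq> \<U>" "finite X"
    then have "\<not> A \<subseteq> \<Union>X" using assms by blast
    then show "(INF u\<in>X. principal (A - u)) \<noteq> bot"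
      using X by (auto simp: INF_principal_finite principal_eq_bot_iff)
  qed
  then obtain U where U: "ultra U" "U \<le> (INF u\<in>\<U>. principal (A - u))"
    by (rule ex_ultra_le)
  have "eventually (\<lambda>x. x \<in> A \<and> x \<notin> u) U" if "u \<in> \<U>" for u
  proof -
    have "U \<le> principal (A - u)"
      using U(2) that by (meson INF_lower order_trans)
    then show ?thesis by (simp add: le_principal)
  qed
  with U(1) that show thesis by blast
qed

text \<open>An ultrafilter that avoids every member of an open cover contradicts its own limit,
  since it must enter a member of the cover around that limit.\<close>

lemma compactin_ultraI:
  assumes "A \<subseteq> topspace X"
    and lim: "\<And>U. ultra U \<Longrightarrow> eventually (\<lambda>x. x \<in> A) U \<Longrightarrow> \<exists>l\<in>A. limitin X (\<lambda>x. x) l U"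
  shows "compactin X A"
  unfolding compactin_def
proof (intro conjI allI impI)
  fix \<U> assume \<U>: "Ball \<U> (openin X) \<and> A \<subseteq> \<Union>\<U>"
  show "\<exists>\<F>. finite \<F> \<and> \<F> \<subseteq> \<U> \<and> A \<subseteq> \<Union>\<F>"
  proof (rule ccontr)
    assume "\<nexists>\<F>. finite \<F> \<and> \<F> \<subseteq> \<U> \<and> A \<subseteq> \<Union>\<F>"
    then have no: "\<And>\<F>. finite \<F> \<Longrightarrow> \<F> \<subseteq> \<U> \<Longrightarrow> \<not> A \<subseteq> \<Union>\<F>" by blast
    obtain U where U: "ultra U" "\<And>u. u \<in> \<U> \<Longrightarrow> eventually (\<lambda>x. x \<in> A \<and> x \<notin> u) U"
      using no_finite_subcover_ultra[OF no] by blast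
    \<comment> \<open>Membership in \<open>A\<close> is only known through a member of the cover;
      one exists because the empty family does not cover \<open>A\<close>.\<close>
    obtain u where "u \<in> \<U>"
      using no[of "{}"] \<U> by auto
    then have "eventually (\<lambda>x. x \<in> A) U"
      by (rule eventually_mono[OF U(2)]) simp
    then obtain l where l: "l \<in> A" "limitin X (\<lambda>x. x) l U"
      using lim U(1) by blast
    then obtain u where u: "u \<in> \<U>" "l \<in> u" using \<U> by blast
    then have "eventually (\<lambda>x. x \<in> u) U"
      using limitinD[OF l(2), of u] \<U> by blast
    with U(2)[OF u(1)] have "eventually (\<lambda>x. False) U"
      by (auto elim: eventually_elim2)
    then show False using ultra_not_bot[OF U(1)] by simp
  qed
qed (use assms in auto)

text \<open>Regularity lets a cover of the closure be refined by closures of open sets, so that only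
  limits along the range itself have to be known.\<close>

lemma compactin_closure_of_range_ultraI:
  assumes reg: "regular_space X"
    and top: "range f \<subseteq> topspace X"
    and lim: "\<And>U. ultra U \<Longrightarrow> \<exists>l. limitin X f l U"
  shows "compactin X (X closure_of range f)"
  unfolding compactin_def
proof (intro conjI allI impI)
  show "X closure_of range f \<subseteq> topspace X"
    by (rule closure_of_subset_topspace)
  fix \<U> assume \<U>: "Ball \<U> (openin X) \<and> X closure_of range f \<subseteq> \<Union>\<U>"
  \<comment> \<open>The refinement of the cover. The case split asks whether the preimages of
    finitely many of its members cover the index type.\<close>
  define \<V> where "\<V> = {V. openin X V \<and> (\<exists>D u. closedin X D \<and> V \<subseteq> D \<and> D \<subseteq> u \<and> u \<in> \<U>)}"
  show "\<exists>\<F>. finite \<F> \<and> \<F> \<subseteq> \<U> \<and> X closure_of range f \<subseteq> \<Union>\<F>"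
  proof (cases "\<exists>\<F>. finite \<F> \<and> \<F> \<subseteq> (\<lambda>V. f -` V) ` \<V> \<and> UNIV \<subseteq> \<Union>\<F>")
    case True
    then obtain \<G> where \<G>: "finite \<G>" "\<G> \<subseteq> \<V>" "UNIV \<subseteq> \<Union>((\<lambda>V. f -` V) ` \<G>)"
      by (metis finite_subset_image)
    have "\<forall>V\<in>\<G>. \<exists>D u. closedin X D \<and> V \<subseteq> D \<and> D \<subseteq> u \<and> u \<in> \<U>"
      using \<G>(2) by (auto simp: \<V>_def)
    then obtain D u where Du: "\<And>V. V \<in> \<G> \<Longrightarrow> closedin X (D V) \<and> V \<subseteq> D V \<and> D V \<subseteq> u V \<and> u V \<in> \<U>"
      by metis
    have "closedin X (\<Union>(D ` \<G>))"
      using \<G>(1) Du by (intro closedin_Union) auto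
    moreover have "range f \<subseteq> \<Union>(D ` \<G>)"
      using \<G>(3) Du by blast
    ultimately have "X closure_of range f \<subseteq> \<Union>(D ` \<G>)"
      by (intro closure_of_minimal)
    also have "\<dots> \<subseteq> \<Union>(u ` \<G>)"
      using Du by blast
    finally show ?thesis
      using \<G>(1) Du by (intro exI[of _ "u ` \<G>"]) auto
  next
    case False
    obtain U where U: "ultra U" "\<And>V. V \<in> \<V> \<Longrightarrow> eventually (\<lambda>x. f x \<notin> V) U"
    proof (rule no_finite_subcover_ultra[of "(\<lambda>V. f -` V) ` \<V>" UNIV])
      fix U assume U: "ultra U" "\<And>u. u \<in> (\<lambda>V. f -` V) ` \<V> \<Longrightarrow> eventually (\<lambda>x. x \<in> UNIV \<and> x \<notin> u) U"
      have "eventually (\<lambda>x. f x \<notin> V) U" if "V \<in> \<V>" for V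
        using U(2)[of "f -` V"] that by simp
      then show thesis by (rule that[OF U(1)])
    next
      fix \<F> assume "finite \<F>" "\<F> \<subseteq> (\<lambda>V. f -` V) ` \<V>"
      then show "\<not> UNIV \<subseteq> \<Union>\<F>" using False by meson
    qed
    obtain l where l: "limitin X f l U" using lim U(1) by blast
    have "l \<in> X closure_of range f"
      unfolding in_closure_of
    proof (intro conjI allI impI)
      show "l \<in> topspace X" using l by (rule limitin_topspace)
      fix W assume "l \<in> W \<and> openin X W"
      then have "eventually (\<lambda>x. f x \<in> W) U"
        using limitinD[OF l] by blast
      then show "\<exists>y. y \<in> range f \<and> y \<in> W"
        using ultra_not_bot[OF U(1)] eventually_happens by blast
    qed
    then obtain u where u: "u \<in> \<U>" "l \<in> u" "openin X u" using \<U> by blast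
    then obtain V D where "openin X V" "closedin X D" "l \<in> V" "V \<subseteq> D" "D \<subseteq> u"
      using reg unfolding neighbourhood_base_of_closedin[symmetric] neighbourhood_base_of
      by metis
    then have V: "V \<in> \<V>" "openin X V" "l \<in> V" using u by (auto simp: \<V>_def)
    then have "eventually (\<lambda>x. f x \<in> V) U"
      using limitinD[OF l] by blast
    with U(2)[OF V(1)] have "eventually (\<lambda>x. False) U"
      by (auto elim: eventually_elim2)
    then show ?thesis using ultra_not_bot[OF U(1)] by simp
  qed
qed

text \<open>If no point were a limit, each would have an open neighbourhood that \<open>f\<close>
  eventually avoids, by the dichotomy for ultrafilters; finitely many of these cover the
  space.\<close>

lemma compact_space_ultra_limit:
  assumes "compact_space X" and U: "ultra U" and ev: "eventually (\<lambda>i. f i \<in> topspace X) U"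
  obtains l where "l \<in> topspace X" "limitin X f l U"
proof -
  have "\<exists>l\<in>topspace X. limitin X f l U"
  proof (rule ccontr)
    assume no: "\<not> ?thesis"
    define \<U> where "\<U> = {W. openin X W \<and> eventually (\<lambda>i. f i \<notin> W) U}"
    have "topspace X \<subseteq> \<Union>\<U>"
    proof
      fix l assume "l \<in> topspace X"
      with no obtain W where "openin X W" "l \<in> W" "\<not> eventually (\<lambda>i. f i \<in> W) U"
        by (auto simp: limitin_def)
      then show "l \<in> \<Union>\<U>"
        using ultraD[OF U] by (auto simp: \<U>_def)
    qed
    moreover have "\<forall>W\<in>\<U>. openin X W" by (simp add: \<U>_def)
    ultimately obtain \<F> where \<F>: "finite \<F>" "\<F> \<subseteq> \<U>" "topspace X \<subseteq> \<Union>\<F>"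
      using assms(1) by (auto simp: compact_space_alt)
    have "eventually (\<lambda>i. \<forall>W\<in>\<F>. f i \<notin> W) U"
      using \<F> by (subst eventually_ball_finite_distrib) (auto simp: \<U>_def)
    with ev have "eventually (\<lambda>i. False) U"
      by eventually_elim (use \<F> in blast)
    then show False using ultra_not_bot[OF U] by simp
  qed
  with that show thesis by blast
qed

lemma bounded_ultra_limit:
  fixes f :: "'i \<Rightarrow> real"
  assumes U: "ultra U" and ev: "eventually (\<lambda>i. \<bar>f i\<bar> \<le> k) U"
  obtains l where "(f \<longlongrightarrow> l) U"
proof -
  have "compact_space (subtopology euclidean {-k..k})"
    by (simp add: compact_space_subtopology)
  moreover have "eventually (\<lambda>i. f i \<in> topspace (subtopology euclidean {-k..k})) U"
    using ev by eventually_elim auto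
  ultimately obtain l where "limitin (subtopology euclidean {-k..k}) f l U"
    using U compact_space_ultra_limit by blast
  then show thesis using that by (auto simp: limitin_subtopology)
qed

section \<open>The weak topology\<close>

lemma topspace_weak_top [simp]: "topspace weak_top = UNIV"
proof -
  have "(\<lambda>x. 0::real) -` UNIV \<in> {(\<phi> -` U) | (\<phi> :: 'a \<Rightarrow> real) U. bounded_linear \<phi> \<and> open U}"
    using bounded_linear_zero by blast
  from Union_upper[OF this] have "UNIV \<subseteq> \<Union>{(\<phi> -` U) | (\<phi> :: 'a \<Rightarrow> real) U. bounded_linear \<phi> \<and> open U}"
    unfolding vimage_UNIV .
  then show ?thesis
    unfolding weak_top_def topology_generated_by_topspace by (rule top.extremum_uniqueI)
qed

lemma openin_weak_top_vimage:
  fixes \<phi> :: "'a::real_normed_vector \<Rightarrow> real"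
  shows "bounded_linear \<phi> \<Longrightarrow> open U \<Longrightarrow> openin weak_top (\<phi> -` U)"
  unfolding weak_top_def by (rule topology_generated_by_Basis) blast

lemma continuous_map_weak_top_functional:
  fixes \<phi> :: "'a::real_normed_vector \<Rightarrow> real"
  assumes "bounded_linear \<phi>"
  shows "continuous_map weak_top euclidean \<phi>"
  using openin_weak_top_vimage[OF assms] by (auto simp: continuous_map_def vimage_def)

text \<open>The converse direction is an induction over the generation of open sets: convergence
  tested on subbasic sets passes to finite intersections and unions.\<close>

lemma limitin_weak_top:
  "limitin weak_top f l F \<longleftrightarrow> (\<forall>\<phi>. bounded_linear \<phi> \<longrightarrow> ((\<lambda>i. \<phi> (f i) :: real) \<longlongrightarrow> \<phi> l) F)"
    (is "?L \<longleftrightarrow> ?R")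
proof
  assume ?L
  then show ?R
    using continuous_map_limit[OF continuous_map_weak_top_functional] by (fastforce simp: o_def)
next
  assume R: ?R
  have "l \<in> W \<longrightarrow> eventually (\<lambda>i. f i \<in> W) F"
    if "generate_topology_on {(\<phi> -` U) | (\<phi> :: 'a \<Rightarrow> real) U. bounded_linear \<phi> \<and> open U} W" for W
    using that
  proof induction
    case (Int a b)
    then show ?case by (auto intro: eventually_conj)
  next
    case (UN K)
    show ?case
    proof
      assume "l \<in> \<Union>K"
      then obtain k where "k \<in> K" "l \<in> k" by blast
      then have "eventually (\<lambda>i. f i \<in> k) F" using UN by blast
      then show "eventually (\<lambda>i. f i \<in> \<Union>K) F"
        by (rule eventually_mono) (use \<open>k \<in> K\<close> in blast)
    qed
  next
    case (Basis s)
    then show ?case using R by (auto simp: tendsto_def)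
  qed auto
  then show ?L
    by (auto simp: limitin_def) (auto simp: weak_top_def openin_topology_generated_by_iff)
qed

text \<open>An open and a closed ball of the line, pulled back by one functional, settle the
  subbasic sets; intersections and unions inherit the property. Needed for weak closures of left
  orbits.\<close>

lemma regular_space_weak_top: "regular_space (weak_top :: 'a::real_normed_vector topology)"
  unfolding neighbourhood_base_of_closedin[symmetric] neighbourhood_base_of
proof safe
  fix W and x :: 'a assume "openin weak_top W" "x \<in> W"
  then have "generate_topology_on {(\<phi> -` U) | (\<phi> :: 'a \<Rightarrow> real) U. bounded_linear \<phi> \<and> open U} W"
    by (simp add: weak_top_def openin_topology_generated_by_iff)
  then show "\<exists>U V. openin weak_top U \<and> closedin weak_top V \<and> x \<in> U \<and> U \<subseteq> V \<and> V \<subseteq> W"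
    using \<open>x \<in> W\<close>
  proof induction
    case (Int a b)
    then obtain U V U' V' where "openin weak_top U \<and> closedin weak_top V \<and> x \<in> U \<and> U \<subseteq> V \<and> V \<subseteq> a"
      "openin weak_top U' \<and> closedin weak_top V' \<and> x \<in> U' \<and> U' \<subseteq> V' \<and> V' \<subseteq> b"
      by blast
    then show ?case
      by (intro exI[of _ "U \<inter> U'"] exI[of _ "V \<inter> V'"]) auto
  next
    case (UN K)
    then show ?case by (meson UnionE Union_upper subset_trans)
  next
    case (Basis s)
    then obtain \<phi> :: "'a \<Rightarrow> real" and O' where *: "s = \<phi> -` O'" "bounded_linear \<phi>" "open O'" by blast
    then obtain e where e: "e > 0" "cball (\<phi> x) e \<subseteq> O'"
      using Basis open_contains_cball by (metis vimageE)
    have "closedin weak_top {y \<in> topspace weak_top. \<phi> y \<in> cball (\<phi> x) e}"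
      by (rule closedin_continuous_map_preimage[OF continuous_map_weak_top_functional[OF *(2)]]) simp
    then show ?case
      using * e openin_weak_top_vimage[OF *(2), of "ball (\<phi> x) e"]
      by (intro exI[of _ "\<phi> -` ball (\<phi> x) e"] exI[of _ "\<phi> -` cball (\<phi> x) e"]) (auto simp: vimage_def)
  qed auto
qed

section \<open>Hilbert spaces\<close>

text \<open>In the application \<open>e n\<close> bounds a multiple of the excess of a quadratic
  functional at \<open>u n\<close> over its infimum; the assumption then comes from the
  parallelogram law.\<close>

lemma minimizing_sequence_convergent:
  fixes u :: "nat \<Rightarrow> 'a::{real_inner, complete_space}"
  assumes "\<And>m n. (norm (u m - u n))\<^sup>2 \<le> e m + e n" and e: "e \<longlonglongrightarrow> (0::real)"
  obtains l where "u \<longlonglongrightarrow> l"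
proof -
  have "Cauchy u"
  proof (rule CauchyI)
    fix r :: real assume "r > 0"
    then have "eventually (\<lambda>n. e n < r\<^sup>2 / 2) sequentially"
      using e by (intro order_tendstoD) auto
    then obtain N where N: "\<And>n. n \<ge> N \<Longrightarrow> e n < r\<^sup>2 / 2"
      by (auto simp: eventually_sequentially)
    have "norm (u m - u n) < r" if "m \<ge> N" "n \<ge> N" for m n
    proof -
      have "(norm (u m - u n))\<^sup>2 < r\<^sup>2"
        using assms(1)[of m n] N[OF that(1)] N[OF that(2)] by simp
      then show ?thesis
        using \<open>r > 0\<close> by (simp add: power_less_imp_less_base)
    qed
    then show "\<exists>M. \<forall>m\<ge>M. \<forall>n\<ge>M. norm (u m - u n) < r" by blast
  qed
  then obtain l where "u \<longlonglongrightarrow> l"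
    using Cauchy_convergent_iff convergent_def by blast
  then show thesis by (rule that)
qed

lemma parallelogram_midpoint:
  fixes x y :: "'a::real_inner"
  shows "(norm (x - y))\<^sup>2 = 2 * (norm x)\<^sup>2 + 2 * (norm y)\<^sup>2 - 4 * (norm ((1/2) *\<^sub>R (x + y)))\<^sup>2"
  unfolding power2_norm_eq_inner by (simp add: algebra_simps inner_commute)

text \<open>Both the nearest point of a closed convex set and the representing vector of a functional
  minimise a quadratic functional of this form.\<close>

lemma quadratic_minimum:
  fixes C :: "'a::{real_inner, complete_space} set" and \<phi> :: "'a \<Rightarrow> real"
  assumes C: "C \<noteq> {}" "closed C" "convex C" and \<phi>: "bounded_linear \<phi>"
  obtains p where "p \<in> C" "\<And>z. z \<in> C \<Longrightarrow> \<phi> (z - p) \<le> p \<bullet> (z - p)"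
proof -
  interpret bounded_linear \<phi> by fact
  \<comment> \<open>For \<open>\<phi> x = a \<bullet> x\<close> this is
    \<open>(norm (x - a))\<^sup>2\<close> up to an additive constant.\<close>
  define q where "q x = (norm x)\<^sup>2 - 2 * \<phi> x" for x
  obtain K where K: "\<And>x. \<bar>\<phi> x\<bar> \<le> K * norm x"
    using bounded by (auto simp: mult.commute)
  have below: "q x \<ge> - K\<^sup>2" for x
  proof -
    have "0 \<le> (norm x - K)\<^sup>2" by simp
    then have "2 * (K * norm x) \<le> (norm x)\<^sup>2 + K\<^sup>2"
      by (simp add: power2_diff algebra_simps)
    then show ?thesis using K[of x] by (simp add: q_def abs_le_iff)
  qed
  define d where "d = Inf (q ` C)"
  have bdd: "bdd_below (q ` C)" using below by (auto intro!: bdd_belowI)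
  have d_le: "d \<le> q x" if "x \<in> C" for x
    unfolding d_def using bdd that by (intro cInf_lower) auto
  have "\<exists>x\<in>C. q x < d + inverse (Suc n)" for n
    using cInf_lessD[of "q ` C" "d + inverse (Suc n)"] C(1) by (auto simp: d_def)
  then obtain u where u: "\<And>n. u n \<in> C" "\<And>n. q (u n) < d + inverse (Suc n)" by metis
  have quad: "(norm (x - y))\<^sup>2 \<le> 2 * (q x - d) + 2 * (q y - d)" if "x \<in> C" "y \<in> C" for x y
  proof -
    have "(1/2) *\<^sub>R (x + y) \<in> C"
      using convexD[OF C(3) that, of "1/2" "1/2"] by (simp add: scaleR_right_distrib)
    from d_le[OF this] show ?thesis
      using parallelogram_midpoint[of x y] by (simp add: q_def scaleR add algebra_simps)
  qed
  obtain p where p: "u \<longlonglongrightarrow> p"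
  proof (rule minimizing_sequence_convergent)
    show "(norm (u m - u n))\<^sup>2 \<le> 2 * inverse (Suc m) + 2 * inverse (Suc n)" for m n
      using quad[OF u(1) u(1), of m n] u(2)[of m] u(2)[of n] by argo
    show "(\<lambda>n. 2 * inverse (real (Suc n))) \<longlonglongrightarrow> 0"
      using tendsto_mult[OF tendsto_const LIMSEQ_inverse_real_of_nat, of 2] by simp
  qed
  have pC: "p \<in> C"
    using C(2) u(1) p by (rule closed_sequentially)
  have "(\<lambda>n. q (u n)) \<longlonglongrightarrow> q p"
    unfolding q_def by (intro tendsto_intros p tendsto)
  moreover have "(\<lambda>n. d + inverse (real (Suc n))) \<longlonglongrightarrow> d"
    using tendsto_add[OF tendsto_const LIMSEQ_inverse_real_of_nat, of d] by simp
  ultimately have "q p \<le> d"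
    using u(2) by (intro LIMSEQ_le) (auto intro: less_imp_le)
  have q_shift: "q (p + t *\<^sub>R w) = q p + 2 * t * (p \<bullet> w) + t\<^sup>2 * (norm w)\<^sup>2 - 2 * t * \<phi> w" for t w
    unfolding q_def power2_norm_eq_inner
    by (simp add: add scaleR inner_commute[of w p] power2_eq_square algebra_simps)
  have "\<phi> (z - p) \<le> p \<bullet> (z - p)" if "z \<in> C" for z
  proof -
    \<comment> \<open>First variation: move from \<open>p\<close> towards \<open>z\<close> by the
      fraction \<open>t\<close>, divide by \<open>t\<close>, and later let \<open>t\<close> tend to
      0.\<close>
    have *: "2 * (\<phi> (z - p) - p \<bullet> (z - p)) \<le> t * (norm (z - p))\<^sup>2" if t: "0 < t" "t \<le> 1" for t
    proof -
      have "(1 - t) *\<^sub>R p + t *\<^sub>R z \<in> C"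
        using convexD[OF C(3) pC \<open>z \<in> C\<close>, of "1 - t" t] t by simp
      then have "q p \<le> q ((1 - t) *\<^sub>R p + t *\<^sub>R z)"
        using d_le \<open>q p \<le> d\<close> by force
      also have "(1 - t) *\<^sub>R p + t *\<^sub>R z = p + t *\<^sub>R (z - p)"
        by (simp add: algebra_simps)
      also have "q (p + t *\<^sub>R (z - p))
          = q p + 2 * t * (p \<bullet> (z - p)) + t\<^sup>2 * (norm (z - p))\<^sup>2 - 2 * t * \<phi> (z - p)"
        using q_shift .
      finally have "0 \<le> 2 * t * (p \<bullet> (z - p)) + t\<^sup>2 * (norm (z - p))\<^sup>2 - 2 * t * \<phi> (z - p)"
        by simp
      then have "t * (2 * (\<phi> (z - p) - p \<bullet> (z - p))) \<le> t * (t * (norm (z - p))\<^sup>2)"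
        by (simp add: algebra_simps power2_eq_square)
      then show ?thesis using t(1) by simp
    qed
    have "((\<lambda>t. t * (norm (z - p))\<^sup>2) \<longlongrightarrow> 0 * (norm (z - p))\<^sup>2) (at_right 0)"
      by (intro tendsto_intros)
    moreover have "eventually (\<lambda>t. 2 * (\<phi> (z - p) - p \<bullet> (z - p)) \<le> t * (norm (z - p))\<^sup>2) (at_right 0)"
      by (rule eventually_mono[OF eventually_at_right_real[OF zero_less_one]], rule *) auto
    ultimately have "2 * (\<phi> (z - p) - p \<bullet> (z - p)) \<le> 0 * (norm (z - p))\<^sup>2"
      by (intro tendsto_lowerbound) auto
    then show ?thesis by simp
  qed
  with pC that show thesis by blast
qed

text \<open>Minimising over the whole space gives the variational inequality at \<open>z\<close> and
  at \<open>- z\<close>, hence equality.\<close>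

lemma riesz_representation:
  fixes \<phi> :: "'a::{real_inner, complete_space} \<Rightarrow> real"
  assumes \<phi>: "bounded_linear \<phi>"
  obtains p where "\<And>z. \<phi> z = p \<bullet> z"
proof -
  interpret bounded_linear \<phi> by fact
  obtain p where p: "\<And>z. \<phi> (z - p) \<le> p \<bullet> (z - p)"
    using quadratic_minimum[of UNIV \<phi>] \<phi> by auto
  have "\<phi> z \<le> p \<bullet> z" for z
    using p[of "z + p"] by simp
  from this[of "- _"] this have "\<phi> z = p \<bullet> z" for z
    using linear_neg[OF linear_axioms] by (simp add: antisym)
  then show thesis by (rule that)
qed

text \<open>With \<open>x \<bullet> z\<close> as the functional, the quantity minimised is the
  squared distance to \<open>x\<close> up to a constant.\<close>

lemma nearest_point_convex:
  fixes C :: "'a::{real_inner, complete_space} set"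
  assumes "C \<noteq> {}" "closed C" "convex C"
  obtains p where "p \<in> C" "\<And>z. z \<in> C \<Longrightarrow> (x - p) \<bullet> (z - p) \<le> 0"
  using quadratic_minimum[OF assms bounded_linear_inner_right[of x]]
  by (auto simp: inner_diff_left)

lemma limitin_weak_top_inner:
  fixes l :: "'a::{real_inner, complete_space}"
  shows "limitin weak_top f l F \<longleftrightarrow> (\<forall>y. ((\<lambda>i. f i \<bullet> y) \<longlongrightarrow> l \<bullet> y) F)"
proof -
  have "((\<lambda>i. \<phi> (f i)) \<longlongrightarrow> \<phi> l) F"
    if lim: "\<forall>y. ((\<lambda>i. f i \<bullet> y) \<longlongrightarrow> l \<bullet> y) F" and \<phi>: "bounded_linear \<phi>" for \<phi> :: "'a \<Rightarrow> real"
  proof -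
    obtain p where "\<And>z. \<phi> z = p \<bullet> z" using riesz_representation[OF \<phi>] by blast
    then show ?thesis using lim by (simp add: inner_commute[of p])
  qed
  then show ?thesis
    unfolding limitin_weak_top using bounded_linear_inner_left by blast
qed

text \<open>The half-space at the point \<open>p\<close> of \<open>C\<close> nearest to
  \<open>l\<close> contains \<open>C\<close>; its inequality survives the weak limit and forces
  \<open>l = p\<close>.\<close>

lemma convex_weak_limit_mem:
  fixes C :: "'a::{real_inner, complete_space} set"
  assumes "closed C" "convex C" and lim: "limitin weak_top f l F" and "F \<noteq> bot"
    and ev: "eventually (\<lambda>i. f i \<in> C) F"
  shows "l \<in> C"
proof -
  have "C \<noteq> {}" using ev \<open>F \<noteq> bot\<close> by (metis empty_iff eventually_happens)
  then obtain p where p: "p \<in> C" "\<And>z. z \<in> C \<Longrightarrow> (l - p) \<bullet> (z - p) \<le> 0"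
    using nearest_point_convex assms by metis
  have "((\<lambda>i. f i \<bullet> (l - p)) \<longlongrightarrow> l \<bullet> (l - p)) F"
    using lim by (simp add: limitin_weak_top_inner)
  moreover have "eventually (\<lambda>i. f i \<bullet> (l - p) \<le> p \<bullet> (l - p)) F"
    using ev by eventually_elim (use p(2) in \<open>force simp: inner_diff inner_commute\<close>)
  ultimately have "l \<bullet> (l - p) \<le> p \<bullet> (l - p)"
    using \<open>F \<noteq> bot\<close> by (intro tendsto_upperbound)
  then have "(l - p) \<bullet> (l - p) \<le> 0"
    by (simp add: inner_diff_left)
  then show ?thesis using p(1) inner_gt_zero_iff[of "l - p"] by (metis eq_iff_diff_eq_0 leD)
qed

text \<open>The ultralimits of \<open>f i \<bullet> y\<close> exist and form a bounded linear
  functional of \<open>y\<close>, whose Riesz vector is the weak limit.\<close>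

lemma bounded_ultra_weak_limit:
  fixes f :: "'i \<Rightarrow> 'a::{real_inner, complete_space}"
  assumes U: "ultra U" and ev: "eventually (\<lambda>i. norm (f i) \<le> R) U"
  obtains l where "limitin weak_top f l U"
proof -
  have bd: "eventually (\<lambda>i. \<bar>f i \<bullet> y\<bar> \<le> R * norm y) U" for y
    using ev by eventually_elim (meson Cauchy_Schwarz_ineq2 mult_right_mono norm_ge_zero order_trans)
  have "\<exists>l. ((\<lambda>i. f i \<bullet> y) \<longlongrightarrow> l) U" for y
    using bounded_ultra_limit[OF U bd] by blast
  then obtain \<phi> where \<phi>: "\<And>y. ((\<lambda>i. f i \<bullet> y) \<longlongrightarrow> \<phi> y) U" by metis
  note nb = ultra_not_bot[OF U]
  have "bounded_linear \<phi>"
  proof (rule bounded_linear_intro)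
    show "\<phi> (x + y) = \<phi> x + \<phi> y" for x y
      using tendsto_unique[OF nb \<phi>] tendsto_add[OF \<phi>[of x] \<phi>[of y]] by (simp add: inner_add_right)
    show "\<phi> (r *\<^sub>R x) = r *\<^sub>R \<phi> x" for r x
      using tendsto_unique[OF nb \<phi>] tendsto_mult_left[OF \<phi>[of x], of r] by simp
    show "norm (\<phi> x) \<le> norm x * R" for x
      using tendsto_upperbound[OF tendsto_rabs[OF \<phi>[of x]] bd nb] by (simp add: mult.commute)
  qed
  then obtain l where "\<And>z. \<phi> z = l \<bullet> z" using riesz_representation by blast
  then have "limitin weak_top f l U"
    using \<phi> by (simp add: limitin_weak_top_inner)
  then show thesis by (rule that)
qed

lemma compact_space_weak_top_convex:
  fixes C :: "'a::{real_inner, complete_space} set"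
  assumes "closed C" "convex C" "bounded C"
  shows "compact_space (subtopology weak_top C)"
proof -
  obtain R where R: "\<And>x. x \<in> C \<Longrightarrow> norm x \<le> R"
    using assms(3) by (auto simp: bounded_iff)
  have "compactin weak_top C"
  proof (rule compactin_ultraI)
    fix U :: "'a filter" assume U: "ultra U" "eventually (\<lambda>x. x \<in> C) U"
    then have "eventually (\<lambda>x. norm x \<le> R) U"
      using R by (auto elim: eventually_mono)
    from bounded_ultra_weak_limit[OF U(1) this] obtain l where "limitin weak_top (\<lambda>x. x) l U"
      by blast
    then show "\<exists>l\<in>C. limitin weak_top (\<lambda>x. x) l U"
      using convex_weak_limit_mem[OF assms(1,2)] U ultra_not_bot by blast
  qed auto
  then show ?thesis by (simp add: compact_space_subtopology)
qed

section \<open>Pointwise and weak convergence of continuous functions on a compact space\<close>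

lemma continuous_map_real_limit:
  assumes "continuous_map X euclideanreal f" "limitin X x z F"
  shows "((\<lambda>i. f (x i)) \<longlongrightarrow> f z) F"
  using continuous_map_limit[OF assms] by (simp add: o_def)

lemma compact_space_real_bounded:
  assumes "compact_space X" "continuous_map X euclideanreal f"
  obtains k where "\<And>x. x \<in> topspace X \<Longrightarrow> \<bar>f x\<bar> \<le> k"
proof -
  have "compactin euclideanreal (f ` topspace X)"
    using assms by (intro image_compactin) (auto simp: compact_space_def)
  then have "bounded (f ` topspace X)"
    by (simp add: compact_imp_bounded)
  then show thesis using that by (auto simp: bounded_iff)
qed

text \<open>If \<open>e \<le> h n (x n)\<close> for all \<open>n\<close>, let \<open>z\<close> be an
  ultralimit of the points: monotonicity gives \<open>e \<le> h m (x n)\<close> for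
  \<open>n \<ge> m\<close>, hence \<open>e \<le> h m z\<close> for all \<open>m\<close>.\<close>

lemma dini:
  assumes X: "compact_space X"
    and cont: "\<And>n. continuous_map X euclideanreal (h n)"
    and dec: "\<And>n x. x \<in> topspace X \<Longrightarrow> h (Suc n) x \<le> h n x"
    and lim: "\<And>x. x \<in> topspace X \<Longrightarrow> (\<lambda>n. h n x) \<longlonglongrightarrow> 0"
    and "e > 0"
  obtains N :: nat where "\<And>x. x \<in> topspace X \<Longrightarrow> h N x < e"
proof -
  have "\<exists>N. \<forall>x\<in>topspace X. h N x < e"
  proof (rule ccontr)
    assume "\<not> ?thesis"
    then have "\<forall>n. \<exists>x\<in>topspace X. e \<le> h n x" by (auto simp: not_less)
    then obtain x where x: "\<And>n. x n \<in> topspace X" "\<And>n. e \<le> h n (x n)" by metis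
    obtain U where U: "ultra U" "U \<le> sequentially"
      using ex_ultra_le[OF sequentially_bot] by blast
    obtain z where z: "z \<in> topspace X" "limitin X x z U"
      using compact_space_ultra_limit[OF X U(1), of x] x(1) by auto
    have "e \<le> h m z" for m
    proof (rule tendsto_lowerbound)
      show "((\<lambda>n. h m (x n)) \<longlongrightarrow> h m z) U"
        using continuous_map_real_limit[OF cont z(2)] .
      have "eventually (\<lambda>n. m \<le> n) U"
        using U(2) by (rule filter_leD) (rule eventually_ge_at_top)
      then show "eventually (\<lambda>n. e \<le> h m (x n)) U"
      proof eventually_elim
        case (elim n)
        have "h n (x n) \<le> h m (x n)"
          using lift_Suc_antimono_le[of "\<lambda>n. h n (x _)", OF dec[OF x(1)] elim] by simp
        then show ?case using x(2)[of n] by linarith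
      qed
    qed (rule ultra_not_bot[OF U(1)])
    then have "e \<le> 0"
      using lim[OF z(1)] by (intro LIMSEQ_le_const) auto
    then show False using \<open>e > 0\<close> by simp
  qed
  with that show thesis by blast
qed

section \<open>Total variation and dominated convergence for functionals on C(X)\<close>

locale bounded_functional =
  fixes X :: "'a topology" and \<psi> :: "('a \<Rightarrow> real) \<Rightarrow> real" and B :: real
  assumes compact: "compact_space X"
    and add: "\<And>f g. continuous_map X euclideanreal f \<Longrightarrow> continuous_map X euclideanreal g \<Longrightarrow>
                \<psi> (\<lambda>x. f x + g x) = \<psi> f + \<psi> g"
    and bound: "\<And>f k. continuous_map X euclideanreal f \<Longrightarrow> (\<And>x. x \<in> topspace X \<Longrightarrow> \<bar>f x\<bar> \<le> k) \<Longrightarrow>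
                  0 \<le> k \<Longrightarrow> \<bar>\<psi> f\<bar> \<le> B * k"
    and B_nonneg: "0 \<le> B"
begin

abbreviation "cont f \<equiv> continuous_map X euclideanreal f"

lemma functional_zero: "\<psi> (\<lambda>x. 0) = 0"
  using bound[of "\<lambda>x. 0" 0] by simp

lemma functional_uminus:
  assumes "cont f" shows "\<psi> (\<lambda>x. - f x) = - \<psi> f"
  using add[OF assms, of "\<lambda>x. - f x"] assms by (simp add: functional_zero continuous_map_minus)

lemma functional_diff:
  assumes "cont f" "cont g" shows "\<psi> (\<lambda>x. f x - g x) = \<psi> f - \<psi> g"
  using add[OF assms(1), of "\<lambda>x. - g x"] assms by (simp add: functional_uminus continuous_map_minus)

text \<open>The value at \<open>f \<ge> 0\<close> of the total variation of \<open>\<psi>\<close>.\<close>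

definition variation :: "('a \<Rightarrow> real) \<Rightarrow> real" where
  "variation f = Sup {\<psi> g | g. cont g \<and> (\<forall>x\<in>topspace X. \<bar>g x\<bar> \<le> f x)}"

lemma variation_upper:
  assumes "cont f" "cont g" "\<And>x. x \<in> topspace X \<Longrightarrow> \<bar>g x\<bar> \<le> f x"
  shows "\<psi> g \<le> variation f"
proof -
  obtain k where k: "\<And>x. x \<in> topspace X \<Longrightarrow> \<bar>f x\<bar> \<le> k"
    using compact_space_real_bounded[OF compact assms(1)] by blast
  have "\<psi> g' \<le> B * \<bar>k\<bar>" if "cont g'" "\<forall>x\<in>topspace X. \<bar>g' x\<bar> \<le> f x" for g'
    using bound[OF that(1), of "\<bar>k\<bar>"] that(2) k by force
  then show ?thesis
    unfolding variation_def using assms by (intro cSup_upper) (auto intro!: bdd_aboveI)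
qed

lemma variation_least:
  assumes "\<And>x. x \<in> topspace X \<Longrightarrow> 0 \<le> f x"
    and "\<And>g. cont g \<Longrightarrow> (\<And>x. x \<in> topspace X \<Longrightarrow> \<bar>g x\<bar> \<le> f x) \<Longrightarrow> \<psi> g \<le> c"
  shows "variation f \<le> c"
  unfolding variation_def
proof (rule cSup_least)
  have "cont (\<lambda>x. 0) \<and> (\<forall>x\<in>topspace X. \<bar>0\<bar> \<le> f x)" using assms(1) by simp
  then show "{\<psi> g | g. cont g \<and> (\<forall>x\<in>topspace X. \<bar>g x\<bar> \<le> f x)} \<noteq> {}" by blast
qed (use assms(2) in auto)

lemma variation_mono:
  assumes "cont g" "\<And>x. x \<in> topspace X \<Longrightarrow> 0 \<le> f x" "\<And>x. x \<in> topspace X \<Longrightarrow> f x \<le> g x"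
  shows "variation f \<le> variation g"
  using assms by (intro variation_least variation_upper) (auto intro: order_trans)

lemma variation_bound:
  assumes "\<And>x. x \<in> topspace X \<Longrightarrow> 0 \<le> f x" "\<And>x. x \<in> topspace X \<Longrightarrow> f x \<le> k" "0 \<le> k"
  shows "variation f \<le> B * k"
  using assms by (intro variation_least order_trans[OF abs_ge_self bound]) (auto intro: order_trans)

text \<open>Riesz decomposition: a function bounded by \<open>f + g\<close> splits into parts
  bounded by \<open>f\<close> and by \<open>g\<close>. The reverse inequality adds competitors for
  the two suprema.\<close>

lemma variation_add:
  assumes f: "cont f" "\<And>x. x \<in> topspace X \<Longrightarrow> 0 \<le> f x"
    and g: "cont g" "\<And>x. x \<in> topspace X \<Longrightarrow> 0 \<le> g x"
  shows "variation (\<lambda>x. f x + g x) = variation f + variation g"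
proof (rule antisym)
  have fg: "cont (\<lambda>x. f x + g x)" by (intro continuous_map_add f g)
  show "variation (\<lambda>x. f x + g x) \<le> variation f + variation g"
  proof (rule variation_least)
    fix u assume u: "cont u" "\<And>x. x \<in> topspace X \<Longrightarrow> \<bar>u x\<bar> \<le> f x + g x"
    \<comment> \<open>The truncation of \<open>u\<close> to the band between \<open>- f\<close> and
      \<open>f\<close>; what it cuts off is bounded by \<open>g\<close>.\<close>
    define v where "v x = max (- f x) (min (u x) (f x))" for x
    have v: "cont v"
      unfolding v_def
      by (intro continuous_map_real_max continuous_map_real_min continuous_map_minus f(1) u(1))
    have "\<psi> u = \<psi> (\<lambda>x. v x + (u x - v x))" by simp
    also have "\<dots> = \<psi> v + \<psi> (\<lambda>x. u x - v x)"
      by (intro add v continuous_map_diff u(1))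
    also have "\<dots> \<le> variation f + variation g"
    proof (intro add_mono variation_upper f(1) g(1) v continuous_map_diff u(1))
      fix x assume x: "x \<in> topspace X"
      then show "\<bar>v x\<bar> \<le> f x" "\<bar>u x - v x\<bar> \<le> g x"
        using f(2)[OF x] g(2)[OF x] u(2)[OF x] by (auto simp: v_def max_def min_def)
    qed
    finally show "\<psi> u \<le> variation f + variation g" .
  qed (use f g in auto)
  have "variation f \<le> variation (\<lambda>x. f x + g x) - variation g"
  proof (rule variation_least[OF f(2)])
    fix u assume u: "cont u" "\<And>x. x \<in> topspace X \<Longrightarrow> \<bar>u x\<bar> \<le> f x"
    have "variation g \<le> variation (\<lambda>x. f x + g x) - \<psi> u"
    proof (rule variation_least[OF g(2)])
      fix v assume v: "cont v" "\<And>x. x \<in> topspace X \<Longrightarrow> \<bar>v x\<bar> \<le> g x"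
      have "\<psi> (\<lambda>x. u x + v x) \<le> variation (\<lambda>x. f x + g x)"
        using u v
        by (intro variation_upper continuous_map_add f(1) g(1)) (auto intro: abs_triangle_ineq[THEN order_trans] add_mono)
      then show "\<psi> v \<le> variation (\<lambda>x. f x + g x) - \<psi> u"
        using add[OF u(1) v(1)] by simp
    qed
    then show "\<psi> u \<le> variation (\<lambda>x. f x + g x) - variation g" by simp
  qed
  then show "variation f + variation g \<le> variation (\<lambda>x. f x + g x)" by simp
qed

lemma variation_diff:
  assumes f: "cont f" and g: "cont g" "\<And>x. x \<in> topspace X \<Longrightarrow> 0 \<le> g x"
    and le: "\<And>x. x \<in> topspace X \<Longrightarrow> g x \<le> f x"
  shows "variation (\<lambda>x. f x - g x) = variation f - variation g"
  using variation_add[of "\<lambda>x. f x - g x" g] assms by (simp add: continuous_map_diff)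

text \<open>Dominated convergence without representing measures: finite maxima of the tails whose variation
  is almost maximal are almost decreasing, so replacing them by their running minima costs little,
  and the running minima converge uniformly by Dini's theorem.\<close>

lemma dominated_convergence:
  assumes f: "\<And>n. cont (f n)" and k: "\<And>n x. x \<in> topspace X \<Longrightarrow> \<bar>f n x\<bar> \<le> k"
    and lim: "\<And>x. x \<in> topspace X \<Longrightarrow> (\<lambda>n. f n x) \<longlonglongrightarrow> 0"
  shows "(\<lambda>n. \<psi> (f n)) \<longlonglongrightarrow> 0"
proof (rule LIMSEQ_I)
  fix r :: real assume "r > 0"
  \<comment> \<open>Leaves room for \<open>B * e\<close> from the uniformly small \<open>h\<close>
    and for \<open>e\<close> from replacing \<open>g\<close> by \<open>h\<close>.\<close>
  define e where "e = r / (B + 2)"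
  have "(B + 2) * e = r" "e > 0"
    using \<open>r > 0\<close> B_nonneg by (auto simp: e_def)
  then have e: "e > 0" "B * e + e < r"
    by (auto simp: distrib_right)
  define a where "a n x = \<bar>f n x\<bar>" for n x
  \<comment> \<open>The pointwise maximum of \<open>a n, ..., a (n + j)\<close>.\<close>
  define mx where "mx n j = rec_nat (a n) (\<lambda>j u x. max (u x) (a (n + Suc j) x)) j" for n j
  have mx_0: "mx n 0 = a n" and mx_Suc: "mx n (Suc j) = (\<lambda>x. max (mx n j x) (a (n + Suc j) x))" for n j
    by (simp_all add: mx_def)
  have a: "cont (a n)" for n unfolding a_def by (intro continuous_map_real_abs f)
  have mx: "cont (mx n j)" for n j
    by (induction j) (auto simp: mx_0 mx_Suc a intro!: continuous_map_real_max)
  have mx_upper: "a (n + i) x \<le> mx n j x" if "i \<le> j" for n i j x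
    using that by (induction j) (auto simp: mx_0 mx_Suc le_Suc_eq max_def intro: order_trans)
  have mx_least: "mx n j x \<le> c" if "\<And>i. i \<ge> n \<Longrightarrow> i \<le> n + j \<Longrightarrow> a i x \<le> c" for n j x c
    using that by (induction j) (auto simp: mx_0 mx_Suc)
  have a0: "0 \<le> a n x" for n x by (simp add: a_def)
  have mx0: "0 \<le> mx n j x" for n j x
    using mx_upper[of 0 j n x] a0[of n x] by simp
  have "bdd_above (range (\<lambda>j. variation (mx n j)))" for n
  proof (rule bdd_aboveI2)
    show "variation (mx n j) \<le> B * \<bar>k\<bar>" for j
      using k by (intro variation_bound mx_least mx0) (auto simp: a_def intro: order_trans[OF _ abs_ge_self])
  qed
  then have upper: "variation (mx n j) \<le> (SUP j. variation (mx n j))" for n j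
    by (intro cSUP_upper) auto
  have "\<exists>j. (SUP j. variation (mx n j)) - e / 2 ^ Suc n < variation (mx n j)" for n
    using less_cSUP_iff[of UNIV "\<lambda>j. variation (mx n j)" "(SUP j. variation (mx n j)) - e / 2 ^ Suc n"]
      \<open>bdd_above (range (\<lambda>j. variation (mx n j)))\<close> e(1) by simp
  \<comment> \<open>The window from \<open>n\<close> to \<open>n + J n\<close> is so long that
    extending it raises the variation by at most \<open>e / 2 ^ Suc n\<close>.\<close>
  then obtain J where J: "\<And>n. (SUP j. variation (mx n j)) - e / 2 ^ Suc n < variation (mx n (J n))"
    by metis
  define g where "g n = mx n (J n)" for n
  have g: "cont (g n)" and g0: "0 \<le> g n x" for n x by (auto simp: g_def mx mx0)
  have step: "variation (\<lambda>x. max (g n x) (g (Suc n) x) - g n x) \<le> e / 2 ^ Suc n" for n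
  proof -
    let ?m = "\<lambda>x. max (g n x) (g (Suc n) x)"
    have m: "cont ?m" by (intro continuous_map_real_max g)
    \<comment> \<open>The windows starting at \<open>n\<close> and at \<open>Suc n\<close> must both
      fit into one that starts at \<open>n\<close>; the outer \<open>Suc\<close> accounts for the
      shifted start.\<close>
    define j where "j = max (J n) (Suc (J (Suc n)))"
    have a_le: "a i x \<le> mx n j x" if "i \<ge> n" "i \<le> n + j" for i x
      using mx_upper[of "i - n" j n x] that by simp
    have "?m x \<le> mx n j x" for x
      unfolding g_def by (intro max.boundedI mx_least a_le) (auto simp: j_def)
    then have "variation ?m \<le> variation (mx n j)"
      by (intro variation_mono mx) (auto simp: g0 le_max_iff_disj)
    also have "\<dots> \<le> variation (g n) + e / 2 ^ Suc n"
      using upper[of n j] J[of n] by (simp add: g_def)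
    finally show ?thesis
      using variation_diff[OF m g(1), of n] g0 by simp
  qed
  \<comment> \<open>The running minimum of \<open>g 0, ..., g n\<close>, decreasing as Dini's
    theorem requires.\<close>
  define h where "h n = rec_nat (g 0) (\<lambda>n u x. min (u x) (g (Suc n) x)) n" for n
  have h_0: "h 0 = g 0" and h_Suc: "h (Suc n) = (\<lambda>x. min (h n x) (g (Suc n) x))" for n
    by (simp_all add: h_def)
  have h: "cont (h n)" for n
    by (induction n) (auto simp: h_0 h_Suc g intro!: continuous_map_real_min)
  have h0: "0 \<le> h n x" for n x
    by (induction n) (auto simp: h_0 h_Suc g0)
  have hg: "h n x \<le> g n x" for n x
    by (cases n) (auto simp: h_0 h_Suc)
  \<comment> \<open>The right-hand side is the sum of the errors \<open>e / 2 ^ Suc i\<close> over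
    \<open>i < n\<close>.\<close>
  have close: "variation (\<lambda>x. g n x - h n x) \<le> e - e / 2 ^ n" for n
  proof (induction n)
    case 0
    then show ?case using variation_bound[of "\<lambda>x. 0" 0] by (simp add: h_0)
  next
    case (Suc n)
    have "g (Suc n) x - h (Suc n) x \<le> (max (g n x) (g (Suc n) x) - g n x) + (g n x - h n x)" for x
      using hg[of n x] by (auto simp: h_Suc min_def max_def)
    then have "variation (\<lambda>x. g (Suc n) x - h (Suc n) x)
        \<le> variation (\<lambda>x. (max (g n x) (g (Suc n) x) - g n x) + (g n x - h n x))"
      using hg[of "Suc n"]
      by (intro variation_mono continuous_map_add continuous_map_diff continuous_map_real_max g h) auto
    also have "\<dots> = variation (\<lambda>x. max (g n x) (g (Suc n) x) - g n x) + variation (\<lambda>x. g n x - h n x)"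
      using hg by (intro variation_add continuous_map_diff continuous_map_real_max g h) auto
    also have "\<dots> \<le> e / 2 ^ Suc n + (e - e / 2 ^ n)"
      by (intro add_mono step Suc)
    also have "\<dots> = e - e / 2 ^ Suc n" by (simp add: field_simps)
    finally show ?case .
  qed
  have "(\<lambda>n. h n x) \<longlonglongrightarrow> 0" if x: "x \<in> topspace X" for x
  proof (rule LIMSEQ_I)
    fix c :: real assume "c > 0"
    then obtain N where N: "\<And>n. n \<ge> N \<Longrightarrow> \<bar>f n x\<bar> < c / 2"
      using LIMSEQ_D[OF lim[OF x], of "c / 2"] by auto
    have "g n x \<le> c / 2" if "n \<ge> N" for n
      unfolding g_def using that N by (intro mx_least) (auto simp: a_def intro: less_imp_le)
    then have "norm (h n x - 0) < c" if "n \<ge> N" for n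
      using that hg[of n x] h0[of n x] \<open>c > 0\<close> by fastforce
    then show "\<exists>N. \<forall>n\<ge>N. norm (h n x - 0) < c" by blast
  qed
  moreover have "h (Suc n) x \<le> h n x" for n x by (simp add: h_Suc)
  ultimately obtain N where N: "\<And>x. x \<in> topspace X \<Longrightarrow> h N x < e"
    using dini[of X h, OF compact h _ _ e(1)] by blast
  have h_dec: "h n x \<le> h N x" if "N \<le> n" for n x
    using that by (induction rule: dec_induct) (auto simp: h_Suc)
  have "norm (\<psi> (f n) - 0) < r" if "N \<le> n" for n
  proof -
    have "\<bar>\<psi> (f n)\<bar> \<le> variation (a n)"
      using variation_upper[OF a f, of n n] variation_upper[OF a continuous_map_minus[OF f], of n n]
      by (auto simp: a_def functional_uminus[OF f] abs_le_iff)
    also have "\<dots> \<le> variation (g n)"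
      using mx_upper[of 0 "J n" n] by (intro variation_mono g a0) (simp add: g_def)
    also have "\<dots> = variation (h n) + variation (\<lambda>x. g n x - h n x)"
      using variation_diff[of "g n" "h n"] g h h0 hg by simp
    also have "\<dots> \<le> B * e + (e - e / 2 ^ n)"
      using order_trans[OF h_dec[OF that] less_imp_le[OF N]] e(1)
      by (intro add_mono close variation_bound h0) auto
    also have "\<dots> \<le> B * e + e" using e(1) by simp
    also have "\<dots> < r" by (rule e)
    finally show ?thesis by simp
  qed
  then show "\<exists>N. \<forall>n\<ge>N. norm (\<psi> (f n) - 0) < r" by blast
qed

end

text \<open>An ultrafilter avoiding all the sets \<open>V d\<close> would converge to some
  \<open>z\<close> and, by continuity of the finitely many functions, enter
  \<open>V z\<close>.\<close>

lemma finite_continuous_net: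
  fixes A :: "('a \<Rightarrow> real) set"
  assumes X: "compact_space X" and A: "finite A" "\<And>f. f \<in> A \<Longrightarrow> continuous_map X euclideanreal f" and "e > 0"
  obtains D where "finite D" "D \<subseteq> topspace X" "\<And>x. x \<in> topspace X \<Longrightarrow> \<exists>d\<in>D. \<forall>f\<in>A. \<bar>f x - f d\<bar> < e"
proof -
  define V where "V d = {x. \<forall>f\<in>A. \<bar>f x - f d\<bar> < e}" for d
  have "\<exists>\<F>. finite \<F> \<and> \<F> \<subseteq> V ` topspace X \<and> topspace X \<subseteq> \<Union>\<F>"
  proof (rule ccontr)
    assume "\<not> ?thesis"
    then have no: "\<And>\<F>. finite \<F> \<Longrightarrow> \<F> \<subseteq> V ` topspace X \<Longrightarrow> \<not> topspace X \<subseteq> \<Union>\<F>" by blast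
    obtain U where U: "ultra U" "\<And>u. u \<in> V ` topspace X \<Longrightarrow> eventually (\<lambda>x. x \<in> topspace X \<and> x \<notin> u) U"
      using no_finite_subcover_ultra[OF no] by blast
    have "topspace X \<noteq> {}" using no[of "{}"] by auto
    then obtain d where "V d \<in> V ` topspace X" by blast
    from U(2)[OF this] have "eventually (\<lambda>x. x \<in> topspace X) U"
      by (rule eventually_mono) simp
    then obtain z where z: "z \<in> topspace X" "limitin X (\<lambda>x. x) z U"
      using compact_space_ultra_limit[OF X U(1), of "\<lambda>x. x"] by blast
    have "eventually (\<lambda>x. \<bar>f x - f z\<bar> < e) U" if "f \<in> A" for f
      using continuous_map_real_limit[OF A(2)[OF that] z(2)] \<open>e > 0\<close> by (auto dest: tendstoD simp: dist_real_def)
    then have "eventually (\<lambda>x. x \<in> V z) U"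
      using A(1) by (simp add: V_def eventually_ball_finite_distrib)
    moreover have "eventually (\<lambda>x. x \<notin> V z) U"
      using U(2)[of "V z"] z(1) by (auto elim: eventually_mono)
    ultimately have "eventually (\<lambda>x. False) U"
      by eventually_elim simp
    then show False using ultra_not_bot[OF U(1)] by simp
  qed
  then obtain D where "finite D" "D \<subseteq> topspace X" "topspace X \<subseteq> \<Union>(V ` D)"
    by (metis finite_subset_image)
  then show thesis by (intro that[of D]) (auto simp: V_def subset_iff)
qed

text \<open>The sequence is built together with finite sets of points that approximate every point of
  \<open>X\<close> as far as \<open>G\<close> and the functions chosen so far can tell. Any ultralimit of the sequence is
  continuous and agrees with \<open>G\<close> at these points; a limit of such points which the functions cannot
  tell from \<open>x\<close> shows that it agrees with \<open>G\<close> at \<open>x\<close>.\<close>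

lemma pointwise_closure_sequence:
  fixes F :: "'s \<Rightarrow> 'a \<Rightarrow> real"
  assumes X: "compact_space X"
    and F: "\<And>s. continuous_map X euclideanreal (F s)"
    and G: "continuous_map X euclideanreal G"
    and bdd: "\<And>s x. x \<in> topspace X \<Longrightarrow> \<bar>F s x\<bar> \<le> k"
    and lim: "\<And>U g. ultra U \<Longrightarrow> (\<And>x. x \<in> topspace X \<Longrightarrow> ((\<lambda>s. F s x) \<longlongrightarrow> g x) U) \<Longrightarrow>
                continuous_map X euclideanreal g"
    and approx: "\<And>D e. finite D \<Longrightarrow> D \<subseteq> topspace X \<Longrightarrow> e > 0 \<Longrightarrow> \<exists>s\<in>P. \<forall>d\<in>D. \<bar>F s d - G d\<bar> < e"
  obtains \<sigma> :: "nat \<Rightarrow> 's" where "\<And>n. \<sigma> n \<in> P" "\<And>x. x \<in> topspace X \<Longrightarrow> (\<lambda>n. F (\<sigma> n) x) \<longlonglongrightarrow> G x"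
proof -
  define ep where "ep n = inverse (real (Suc n))" for n
  have ep: "ep n > 0" for n by (simp add: ep_def)
  have ep_lim: "ep \<longlonglongrightarrow> 0" using LIMSEQ_inverse_real_of_nat unfolding ep_def .
  \<comment> \<open>The premise sits below the existential so that choice yields a function of all
    \<open>A\<close> and \<open>n\<close>.\<close>
  have "\<exists>D. finite A \<longrightarrow> finite D \<and> D \<subseteq> topspace X \<and>
      (\<forall>x\<in>topspace X. \<exists>d\<in>D. \<forall>f\<in>insert G (F ` A). \<bar>f x - f d\<bar> < ep n)" for A n
  proof (cases "finite A")
    case True
    then have fin: "finite (insert G (F ` A))" by simp
    have "continuous_map X euclideanreal f" if "f \<in> insert G (F ` A)" for f
      using that F G by blast
    from finite_continuous_net[OF X fin this ep] show ?thesis by (metis (no_types, lifting))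
  qed auto
  then obtain net where net: "\<And>A n. finite A \<Longrightarrow> finite (net A n) \<and> net A n \<subseteq> topspace X \<and>
      (\<forall>x\<in>topspace X. \<exists>d\<in>net A n. \<forall>f\<in>insert G (F ` A). \<bar>f x - f d\<bar> < ep n)"
    by metis
  have "\<exists>s. finite D \<and> D \<subseteq> topspace X \<longrightarrow> s \<in> P \<and> (\<forall>d\<in>D. \<bar>F s d - G d\<bar> < ep n)" for D n
    using approx[OF _ _ ep] by blast
  then obtain pick where pick: "\<And>D n. finite D \<Longrightarrow> D \<subseteq> topspace X \<Longrightarrow>
      pick D n \<in> P \<and> (\<forall>d\<in>D. \<bar>F (pick D n) d - G d\<bar> < ep n)"
    by metis
  \<comment> \<open>The state holds the indices chosen so far and the test points. The test points
    are enlarged before the next index is picked, so \<open>\<sigma> n\<close> is accurate on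
    \<open>D (Suc n)\<close>.\<close>
  define st where "st = rec_nat ({}, {})
    (\<lambda>n AD. let D' = snd AD \<union> net (fst AD) n in (insert (pick D' n) (fst AD), D'))"
  define A where "A n = fst (st n)" for n
  define D where "D n = snd (st n)" for n
  define \<sigma> where "\<sigma> n = pick (D (Suc n)) n" for n
  have A_0: "A 0 = {}" and D_0: "D 0 = {}"
    and D_Suc: "D (Suc n) = D n \<union> net (A n) n" and A_Suc: "A (Suc n) = insert (\<sigma> n) (A n)" for n
    by (simp_all add: A_def D_def \<sigma>_def st_def Let_def)
  have finA: "finite (A n)" for n by (induction n) (auto simp: A_0 A_Suc)
  have finD: "finite (D n) \<and> D n \<subseteq> topspace X" for n
    by (induction n) (use net[OF finA] in \<open>auto simp: D_0 D_Suc\<close>)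
  have \<sigma>A: "\<sigma> i \<in> A n" if "i < n" for i n
    using that by (induction n) (auto simp: A_Suc less_Suc_eq)
  have D_mono: "D m \<subseteq> D n" if "m \<le> n" for m n
    using that by (induction rule: dec_induct) (auto simp: D_Suc)
  have \<sigma>: "\<sigma> n \<in> P" "\<And>d. d \<in> D (Suc n) \<Longrightarrow> \<bar>F (\<sigma> n) d - G d\<bar> < ep n" for n
    using pick finD by (auto simp: \<sigma>_def)
  have conv_D: "(\<lambda>n. F (\<sigma> n) d) \<longlonglongrightarrow> G d" if "d \<in> D m" for d m
  proof (rule LIM_zero_cancel, rule Lim_null_comparison[OF _ ep_lim])
    show "eventually (\<lambda>n. norm (F (\<sigma> n) d - G d) \<le> ep n) sequentially"
      using eventually_ge_at_top[of m]
    proof eventually_elim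
      case (elim n)
      then have "d \<in> D (Suc n)" using D_mono[of m "Suc n"] that by auto
      then show ?case using \<sigma>(2) by (simp add: less_imp_le)
    qed
  qed
  have "(\<lambda>n. F (\<sigma> n) x) \<longlonglongrightarrow> G x" if x: "x \<in> topspace X" for x
  proof (rule ccontr)
    assume "\<not> ?thesis"
    then obtain r where r: "r > 0" "\<not> eventually (\<lambda>n. dist (F (\<sigma> n) x) (G x) < r) sequentially"
      by (auto simp: tendsto_iff)
    then have "frequently (\<lambda>n. r \<le> dist (F (\<sigma> n) x) (G x)) sequentially"
      by (simp add: frequently_def not_le)
    then obtain V where V: "ultra V" "V \<le> sequentially" "eventually (\<lambda>n. r \<le> dist (F (\<sigma> n) x) (G x)) V"
      by (rule frequently_ultra)
    note nb = ultra_not_bot[OF V(1)]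
    have "\<exists>l. ((\<lambda>n. F (\<sigma> n) y) \<longlongrightarrow> l) V" if "y \<in> topspace X" for y
      using bounded_ultra_limit[OF V(1), of "\<lambda>n. F (\<sigma> n) y" k] bdd[OF that] by auto
    then obtain g where g: "\<And>y. y \<in> topspace X \<Longrightarrow> ((\<lambda>n. F (\<sigma> n) y) \<longlongrightarrow> g y) V" by metis
    have g_cont: "continuous_map X euclideanreal g"
    proof (rule lim)
      show "ultra (filtermap \<sigma> V)" by (rule ultra_filtermap[OF V(1)])
      show "((\<lambda>s. F s y) \<longlongrightarrow> g y) (filtermap \<sigma> V)" if "y \<in> topspace X" for y
        using g[OF that] by (simp add: filterlim_filtermap)
    qed
    \<comment> \<open>These points imitate \<open>x\<close> for \<open>G\<close> and the first
      \<open>n\<close> functions of the sequence, so each of these functions takes equal values at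
      \<open>x\<close> and at the ultralimit \<open>z\<close> of the points.\<close>
    have "\<exists>d\<in>D (Suc n). \<forall>f\<in>insert G (F ` A n). \<bar>f x - f d\<bar> < ep n" for n
      using net[OF finA, of n n] x by (auto simp: D_Suc)
    then obtain d where d: "\<And>n. d n \<in> D (Suc n)" "\<And>n f. f \<in> insert G (F ` A n) \<Longrightarrow> \<bar>f x - f (d n)\<bar> < ep n"
      by metis
    have dX: "d n \<in> topspace X" for n using d(1) finD by blast
    obtain z where z: "z \<in> topspace X" "limitin X d z V"
      using compact_space_ultra_limit[OF X V(1), of d] dX by auto
    have same: "f z = f x" if f: "continuous_map X euclideanreal f" "\<And>n. n \<ge> m \<Longrightarrow> f \<in> insert G (F ` A n)" for f m
    proof (rule tendsto_unique[OF nb])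
      show "((\<lambda>n. f (d n)) \<longlongrightarrow> f z) V" by (rule continuous_map_real_limit[OF f(1) z(2)])
      have "(\<lambda>n. f (d n)) \<longlonglongrightarrow> f x"
      proof (rule LIM_zero_cancel, rule Lim_null_comparison[OF _ ep_lim])
        show "eventually (\<lambda>n. norm (f (d n) - f x) \<le> ep n) sequentially"
          using eventually_ge_at_top[of m]
        proof eventually_elim
          case (elim n)
          show ?case using d(2)[OF f(2)[OF elim]] by (simp add: abs_minus_commute less_imp_le)
        qed
      qed
      then show "((\<lambda>n. f (d n)) \<longlongrightarrow> f x) V" by (rule tendsto_mono[OF V(2)])
    qed
    have Fz: "F (\<sigma> i) z = F (\<sigma> i) x" for i
      using F \<sigma>A by (intro same[of _ "Suc i"]) auto
    have "G z = G x" using G by (intro same[of _ 0]) auto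
    have "g z = g x"
      using tendsto_unique[OF nb g[OF z(1)]] g[OF x] by (simp add: Fz)
    \<comment> \<open>At the test point \<open>d n\<close> the whole sequence converges to
      \<open>G\<close>; continuity of \<open>g\<close> and \<open>G\<close> then carries the
      equality to \<open>z\<close>.\<close>
    have "g (d n) = G (d n)" for n
      using tendsto_unique[OF nb g[OF dX]] tendsto_mono[OF V(2) conv_D[OF d(1)]] .
    then have "g z = G z"
      using tendsto_unique[OF nb continuous_map_real_limit[OF g_cont z(2)]] continuous_map_real_limit[OF G z(2)] by simp
    with \<open>g z = g x\<close> \<open>G z = G x\<close> have "((\<lambda>n. F (\<sigma> n) x) \<longlongrightarrow> G x) V"
      using g[OF x] by simp
    then have "eventually (\<lambda>n. dist (F (\<sigma> n) x) (G x) < r) V"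
      using r(1) by (auto dest: tendstoD)
    with V(3) have "eventually (\<lambda>n. False) V"
      by eventually_elim simp
    then show False using nb by simp
  qed
  with \<sigma>(1) that show thesis by blast
qed

text \<open>Grothendieck's theorem that pointwise compactness implies weak compactness for bounded sets in
  \<open>C(X)\<close>, in the form needed for orbits.\<close>

lemma (in bounded_functional) pointwise_ultralimit:
  assumes F: "\<And>s. cont (F s)"
    and bdd: "\<And>s x. x \<in> topspace X \<Longrightarrow> \<bar>F s x\<bar> \<le> k"
    and lim: "\<And>U g. ultra U \<Longrightarrow> (\<And>x. x \<in> topspace X \<Longrightarrow> ((\<lambda>s. F s x) \<longlongrightarrow> g x) U) \<Longrightarrow> cont g"
    and U: "ultra U" and G: "\<And>x. x \<in> topspace X \<Longrightarrow> ((\<lambda>s. F s x) \<longlongrightarrow> G x) U"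
  shows "((\<lambda>s. \<psi> (F s)) \<longlongrightarrow> \<psi> G) U"
proof (rule ccontr)
  assume "\<not> ?thesis"
  then obtain r where r: "r > 0" "\<not> eventually (\<lambda>s. dist (\<psi> (F s)) (\<psi> G) < r) U"
    by (auto simp: tendsto_iff)
  \<comment> \<open>The indices whose values stay away from \<open>\<psi> G\<close>. A sequence
    inside \<open>P\<close> that converges pointwise to \<open>G\<close> will contradict dominated
    convergence.\<close>
  define P where "P = {s. \<not> dist (\<psi> (F s)) (\<psi> G) < r}"
  have P: "eventually (\<lambda>s. s \<in> P) U"
    using ultraD[OF U r(2)] by (simp add: P_def)
  have contG: "cont G" using lim[OF U G] .
  obtain \<sigma> where \<sigma>: "\<And>n::nat. \<sigma> n \<in> P" "\<And>x. x \<in> topspace X \<Longrightarrow> (\<lambda>n. F (\<sigma> n) x) \<longlonglongrightarrow> G x"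
  proof (rule pointwise_closure_sequence[where X = X and F = F and G = G and P = P])
    fix D and e :: real assume D: "finite D" "D \<subseteq> topspace X" "e > 0"
    have "eventually (\<lambda>s. \<forall>d\<in>D. \<bar>F s d - G d\<bar> < e) U"
      using D(1)
    proof (rule eventually_ball_finite, intro ballI)
      fix d assume "d \<in> D"
      then show "eventually (\<lambda>s. \<bar>F s d - G d\<bar> < e) U"
        using tendstoD[OF G \<open>e > 0\<close>] D(2) by (auto simp: dist_real_def)
    qed
    with P have "eventually (\<lambda>s. s \<in> P \<and> (\<forall>d\<in>D. \<bar>F s d - G d\<bar> < e)) U"
      by (rule eventually_conj)
    then show "\<exists>s\<in>P. \<forall>d\<in>D. \<bar>F s d - G d\<bar> < e"
      using ultra_not_bot[OF U] eventually_happens by blast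
  qed (use compact F contG bdd lim in blast)+
  have Gk: "\<bar>G x\<bar> \<le> k" if "x \<in> topspace X" for x
    using tendsto_upperbound[OF tendsto_rabs[OF G[OF that]] _ ultra_not_bot[OF U]] bdd[OF that] by simp
  have "(\<lambda>n. \<psi> (\<lambda>x. F (\<sigma> n) x - G x)) \<longlonglongrightarrow> 0"
  proof (rule dominated_convergence)
    show "cont (\<lambda>x. F (\<sigma> n) x - G x)" for n by (intro continuous_map_diff F contG)
    show "\<bar>F (\<sigma> n) x - G x\<bar> \<le> k + k" if "x \<in> topspace X" for n x
      using bdd[OF that, of "\<sigma> n"] Gk[OF that] by simp
    show "(\<lambda>n. F (\<sigma> n) x - G x) \<longlonglongrightarrow> 0" if "x \<in> topspace X" for x
      using LIM_zero[OF \<sigma>(2)[OF that]] .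
  qed
  from LIMSEQ_D[OF this r(1)] obtain n where "\<bar>\<psi> (\<lambda>x. F (\<sigma> n) x - G x)\<bar> < r" by auto
  then have "\<sigma> n \<notin> P"
    using functional_diff[OF F contG] by (simp add: P_def dist_real_def)
  with \<sigma>(1) show False by blast
qed

section \<open>Fixed points from invariant means\<close>

lemma Cb_eq_bcontfun: "Cb = bcontfun"
  by (simp add: Cb_def bcontfun_def)

lemma norm_Bcontfun_le:
  assumes "f \<in> bcontfun" "\<And>t. norm (f t) \<le> b"
  shows "norm (Bcontfun f) \<le> b"
  using assms by (intro norm_bound) (simp add: Bcontfun_inverse)

text \<open>The function \<open>\<lambda>s. \<parallel>T s c - x\<parallel>\<^sup>2\<close> need not lie in \<open>L\<close>; the supremum of \<open>M\<close> over its
  minorants in \<open>L\<close> replaces its mean.\<close>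

lemma fixed_point_of_invariant_functional:
  fixes C :: "'a::{real_inner, complete_space} set" and T :: "'s::semigroup_mult \<Rightarrow> 'a \<Rightarrow> 'a"
    and L :: "('s \<Rightarrow> real) set" and M :: "('s \<Rightarrow> real) \<Rightarrow> real"
  assumes C: "closed C" "convex C" and rep: "representation_on C T" and nonexp: "nonexpansive_on C T"
    and c: "c \<in> C" and bdd: "bounded (range (\<lambda>s. T s c))"
    and L_const: "\<And>a. (\<lambda>s. a) \<in> L"
    and L_add: "\<And>f g. f \<in> L \<Longrightarrow> g \<in> L \<Longrightarrow> (\<lambda>s. f s + g s) \<in> L"
    and L_shift: "\<And>f t. f \<in> L \<Longrightarrow> (\<lambda>s. f (t * s)) \<in> L"
    and L_inner: "\<And>y. (\<lambda>s. T s c \<bullet> y) \<in> L"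
    and M_add: "\<And>f g. f \<in> L \<Longrightarrow> g \<in> L \<Longrightarrow> M (\<lambda>s. f s + g s) = M f + M g"
    and M_scale: "\<And>f r. f \<in> L \<Longrightarrow> M (\<lambda>s. r * f s) = r * M f"
    and M_const: "\<And>a. M (\<lambda>s. a) = a"
    and M_le: "\<And>f b. f \<in> L \<Longrightarrow> (\<And>s. f s \<le> b) \<Longrightarrow> M f \<le> b"
    and M_shift: "\<And>f t. f \<in> L \<Longrightarrow> M (\<lambda>s. f (t * s)) = M f"
  shows "\<exists>x\<in>C. \<forall>s. T s x = x"
proof -
  obtain R where R: "\<And>s. norm (T s c) \<le> R"
    using bdd by (auto simp: bounded_iff)
  have TC: "T s x \<in> C" if "x \<in> C" for s x
    using rep that by (auto simp: representation_on_def)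
  define \<phi> where "\<phi> y = M (\<lambda>s. T s c \<bullet> y)" for y
  have M_inner_le: "\<phi> y \<le> norm y * R" for y
  proof (unfold \<phi>_def, rule M_le[OF L_inner])
    fix s
    have "T s c \<bullet> y \<le> norm (T s c) * norm y" by (rule norm_cauchy_schwarz)
    also have "\<dots> \<le> norm y * R" using mult_left_mono[OF R[of s] norm_ge_zero[of y]] by (simp add: mult.commute)
    finally show "T s c \<bullet> y \<le> norm y * R" .
  qed
  have scale: "\<phi> (r *\<^sub>R y) = r *\<^sub>R \<phi> y" for r y
    using M_scale[OF L_inner, of r y] by (simp add: \<phi>_def)
  have "bounded_linear \<phi>"
  proof (rule bounded_linear_intro)
    show "\<phi> (x + y) = \<phi> x + \<phi> y" for x y
      using M_add[OF L_inner L_inner, of x y] by (simp add: \<phi>_def inner_add_right)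
    show "\<phi> (r *\<^sub>R x) = r *\<^sub>R \<phi> x" for r x by (rule scale)
    show "norm (\<phi> x) \<le> norm x * R" for x
      using M_inner_le[of x] M_inner_le[of "- x"] scale[of "-1" x] by (simp add: abs_le_iff)
  qed
  then obtain p where p: "\<And>y. \<phi> y = p \<bullet> y" using riesz_representation by blast
  \<comment> \<open>The barycentre \<open>p\<close> lies in \<open>C\<close>: averaging the
    half-space inequality at its nearest point \<open>q\<close> over the orbit gives
    \<open>p = q\<close>.\<close>
  obtain q where q: "q \<in> C" "\<And>z. z \<in> C \<Longrightarrow> (p - q) \<bullet> (z - q) \<le> 0"
    using nearest_point_convex[of C p] C c by blast
  have "\<phi> (p - q) \<le> q \<bullet> (p - q)"
    unfolding \<phi>_def using q(2)[OF TC[OF c]] by (intro M_le L_inner) (simp add: inner_diff inner_commute)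
  then have "(p - q) \<bullet> (p - q) \<le> 0" by (simp add: p inner_diff_left)
  then have "p = q" using inner_gt_zero_iff[of "p - q"] by (metis eq_iff_diff_eq_0 leD)
  with q have pC: "p \<in> C" by simp
  have "T t p = p" for t
  proof -
    define y where "y = T t p"
    define h where "h s = (norm (T s c - p))\<^sup>2" for s
    \<comment> \<open>\<open>Sup V\<close> is the lower integral of \<open>h\<close>.\<close>
    define V where "V = {M f | f. f \<in> L \<and> (\<forall>s. f s \<le> h s)}"
    have "\<forall>s. 0 \<le> h s" by (simp add: h_def)
    then have "M (\<lambda>s. 0) \<in> V"
      unfolding V_def using L_const by blast
    have "h s \<le> (R + norm p)\<^sup>2" for s
      unfolding h_def using norm_triangle_ineq4[of "T s c" p] R[of s] by (intro power_mono) auto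
    then have "bdd_above V"
      unfolding V_def by (auto intro!: bdd_aboveI M_le intro: order_trans)
    \<comment> \<open>Adding an affine function of \<open>T s c\<close> turns a minorant of
      \<open>h\<close> into a minorant of the squared distance to \<open>y\<close>; translation by
      \<open>t\<close> turns that back into a minorant of \<open>h\<close>, as
      \<open>y = T t p\<close> and \<open>T t\<close> is nonexpansive.\<close>
    have up: "v + (norm (p - y))\<^sup>2 \<in> V" if "v \<in> V" for v
    proof -
      obtain f where f: "f \<in> L" "\<And>s. f s \<le> h s" "v = M f"
        using \<open>v \<in> V\<close> unfolding V_def by blast
      \<comment> \<open>Chosen so that \<open>(norm (x - y))\<^sup>2 - (norm (x - p))\<^sup>2 = x
        \<bullet> (2 *\<^sub>R (p - y)) + b\<close>; along the orbit the right-hand side has mean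
        \<open>(norm (p - y))\<^sup>2\<close>.\<close>
      define b where "b = (norm (p - y))\<^sup>2 - 2 * (p \<bullet> (p - y))"
      define f' where "f' s = f s + (T s c \<bullet> (2 *\<^sub>R (p - y)) + b)" for s
      have f'L: "f' \<in> L"
        unfolding f'_def by (intro L_add f(1) L_inner L_const)
      have "M f' = M f + (\<phi> (2 *\<^sub>R (p - y)) + b)"
        unfolding f'_def \<phi>_def by (simp add: M_add f(1) L_add L_inner L_const M_const del: inner_scaleR_right)
      also have "\<dots> = v + (norm (p - y))\<^sup>2"
        by (simp add: f(3) p b_def)
      finally have Mf': "M f' = v + (norm (p - y))\<^sup>2" .
      have f'_le: "f' s \<le> (norm (T s c - y))\<^sup>2" for s
      proof -
        have "(norm (T s c - y))\<^sup>2 = h s + (T s c \<bullet> (2 *\<^sub>R (p - y)) + b)"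
          unfolding h_def b_def power2_norm_eq_inner by (simp add: algebra_simps inner_commute)
        then show ?thesis using f(2)[of s] by (simp add: f'_def)
      qed
      have "f' (t * s) \<le> h s" for s
      proof -
        have "f' (t * s) \<le> (norm (T (t * s) c - y))\<^sup>2" by (rule f'_le)
        also have "T (t * s) c = T t (T s c)"
          using rep c by (simp add: representation_on_def)
        also have "norm (T t (T s c) - y) \<le> norm (T s c - p)"
          using nonexp pC TC[OF c] by (simp add: nonexpansive_on_def dist_norm y_def)
        then have "(norm (T t (T s c) - y))\<^sup>2 \<le> h s"
          unfolding h_def by (rule power_mono) simp
        finally show ?thesis .
      qed
      then have "M (\<lambda>s. f' (t * s)) \<in> V"
        unfolding V_def using L_shift[OF f'L, of t] by blast
      then show ?thesis using M_shift[OF f'L, of t] Mf' by simp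
    qed
    \<comment> \<open>\<open>V\<close> is bounded above and stable under adding
      \<open>(norm (p - y))\<^sup>2\<close>, which must therefore vanish.\<close>
    have "Sup V \<le> Sup V - (norm (p - y))\<^sup>2"
    proof (rule cSup_least)
      fix v assume "v \<in> V"
      then show "v \<le> Sup V - (norm (p - y))\<^sup>2"
        using cSup_upper[OF up \<open>bdd_above V\<close>] by fastforce
    qed (use \<open>M (\<lambda>s. 0) \<in> V\<close> in auto)
    then show ?thesis by (simp add: y_def)
  qed
  with pC show ?thesis by blast
qed

text \<open>The real part of the mean serves as the functional on a real class \<open>L\<close>, so
  that membership in \<open>X\<close> has to be shown for functions of \<open>L\<close>
  only.\<close>

lemma fixed_point_of_left_invariant_mean:
  fixes C :: "'a::{real_inner, complete_space} set"
    and T :: "'s::{topological_space, semigroup_mult} \<Rightarrow> 'a \<Rightarrow> 'a"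
    and L :: "('s \<Rightarrow> real) set"
  assumes C: "closed C" "convex C" and rep: "representation_on C T" and nonexp: "nonexpansive_on C T"
    and c: "c \<in> C" and bdd: "bounded (range (\<lambda>s. T s c))"
    and X: "X \<subseteq> Cb" "has_LIM X"
    and L_X: "\<And>f. f \<in> L \<Longrightarrow> (\<lambda>s. complex_of_real (f s)) \<in> X"
    and L_const: "\<And>a. (\<lambda>s. a) \<in> L"
    and L_add: "\<And>f g. f \<in> L \<Longrightarrow> g \<in> L \<Longrightarrow> (\<lambda>s. f s + g s) \<in> L"
    and L_shift: "\<And>f t. f \<in> L \<Longrightarrow> (\<lambda>s. f (t * s)) \<in> L"
    and L_inner: "\<And>y. (\<lambda>s. T s c \<bullet> y) \<in> L"
  shows "\<exists>x\<in>C. \<forall>s. T s x = x"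
proof -
  obtain m where m: "left_invariant_mean_on X m"
    using X(2) by (auto simp: has_LIM_def)
  have m_add: "m (\<lambda>t. f t + g t) = m f + m g" if "f \<in> X" "g \<in> X" for f g
    using m that by (simp add: left_invariant_mean_on_def mean_on_def)
  have m_scale: "m (\<lambda>t. a * f t) = a * m f" if "f \<in> X" for a f
    using m that by (simp add: left_invariant_mean_on_def mean_on_def)
  have m_norm: "cmod (m f) \<le> sup_norm f" if "f \<in> X" for f
    using m that by (simp add: left_invariant_mean_on_def mean_on_def)
  have m_1: "m (\<lambda>_. 1) = 1"
    using m by (simp add: left_invariant_mean_on_def mean_on_def)
  have m_shift: "m (lshift s f) = m f" if "f \<in> X" for s f
    using m that by (simp add: left_invariant_mean_on_def)
  define M where "M f = Re (m (\<lambda>s. complex_of_real (f s)))" for f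
  have M_add: "M (\<lambda>s. f s + g s) = M f + M g" if "f \<in> L" "g \<in> L" for f g
    using m_add[OF L_X L_X, OF that] by (simp add: M_def)
  have M_const: "M (\<lambda>s. a) = a" for a
    using m_scale[OF L_X[OF L_const[of 1]], of "complex_of_real a"] m_1 by (simp add: M_def)
  have M_abs: "\<bar>M f\<bar> \<le> b" if "f \<in> L" "\<And>s. \<bar>f s\<bar> \<le> b" for f b
  proof -
    have "\<bar>M f\<bar> \<le> sup_norm (\<lambda>s. complex_of_real (f s))"
      unfolding M_def using m_norm[OF L_X[OF that(1)]] abs_Re_le_cmod order_trans by blast
    also have "\<dots> \<le> b"
      unfolding sup_norm_def using L_X[OF that(1)] X(1) that(2)
      by (intro norm_Bcontfun_le) (auto simp: Cb_eq_bcontfun)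
    finally show ?thesis .
  qed
  show ?thesis
  proof (rule fixed_point_of_invariant_functional[OF C rep nonexp c bdd L_const L_add L_shift L_inner, where M = M])
    show "M (\<lambda>s. f s + g s) = M f + M g" if "f \<in> L" "g \<in> L" for f g by (rule M_add[OF that])
    show "M (\<lambda>s. r * f s) = r * M f" if "f \<in> L" for f r
      using m_scale[OF L_X[OF that], of "complex_of_real r"] by (simp add: M_def)
    show "M (\<lambda>s. a) = a" for a by (rule M_const)
    show "M (\<lambda>s. f (t * s)) = M f" if "f \<in> L" for f t
      using m_shift[OF L_X[OF that], of t] by (simp add: M_def lshift_def)
    show "M f \<le> b" if f: "f \<in> L" "\<And>s. f s \<le> b" for f b
    proof -
      have "bounded (range (\<lambda>s. complex_of_real (f s)))"
        using L_X[OF f(1)] X(1) by (auto simp: Cb_def)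
      then obtain b' where b': "\<And>s. \<bar>f s\<bar> \<le> b'" by (auto simp: bounded_iff)
      \<comment> \<open>The midpoint of the interval from \<open>- b'\<close> to \<open>b\<close>;
        centring there turns the norm bound of the mean into a one-sided bound.\<close>
      define k where "k = (b - b') / 2"
      have "\<bar>f s + - k\<bar> \<le> (b + b') / 2" for s
        using f(2)[of s] b'[of s] by (simp add: k_def abs_le_iff field_simps)
      then have "\<bar>M (\<lambda>s. f s + - k)\<bar> \<le> (b + b') / 2"
        by (intro M_abs L_add f(1) L_const)
      moreover have "M (\<lambda>s. f s + - k) = M f - k"
        using M_add[OF f(1) L_const, of "- k"] M_const[of "- k"] by simp
      ultimately show ?thesis by (simp add: k_def abs_le_iff field_simps)
    qed
  qed
qed

section \<open>Functions of the orbit\<close>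

lemma continuous_map_to_weak_topI:
  fixes g :: "'b \<Rightarrow> 'a::real_normed_vector"
  assumes "\<And>\<phi> :: 'a \<Rightarrow> real. bounded_linear \<phi> \<Longrightarrow> continuous_map Y euclideanreal (\<lambda>x. \<phi> (g x))"
  shows "continuous_map Y weak_top g"
  unfolding weak_top_def
proof (rule continuous_on_generated_topo)
  fix W assume "W \<in> {(\<phi> -` U) | (\<phi> :: 'a \<Rightarrow> real) U. bounded_linear \<phi> \<and> open U}"
  then obtain \<phi> :: "'a \<Rightarrow> real" and O' where W: "W = \<phi> -` O'" "bounded_linear \<phi>" "open O'" by blast
  then have "openin Y {x \<in> topspace Y. \<phi> (g x) \<in> O'}"
    using openin_continuous_map_preimage[OF assms] by simp
  moreover have "g -` W \<inter> topspace Y = {x \<in> topspace Y. \<phi> (g x) \<in> O'}"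
    using W(1) by auto
  ultimately show "openin Y (g -` W \<inter> topspace Y)" by simp
next
  have "g ` topspace Y \<subseteq> topspace weak_top" by simp
  then show "g ` topspace Y \<subseteq> \<Union>{(\<phi> -` U) | (\<phi> :: 'a \<Rightarrow> real) U. bounded_linear \<phi> \<and> open U}"
    unfolding weak_top_def topology_generated_by_topspace .
qed

text \<open>The neighbourhood from equicontinuity serves the limit map too, the strict bound
  \<open>e / 2\<close> becoming a non-strict one. The \<open>AP\<close> case thus gets continuous
  limit maps as the \<open>WAP\<close> case does.\<close>

lemma weakly_equicontinuous_imp_quasi:
  fixes T :: "'s \<Rightarrow> 'a::real_normed_vector \<Rightarrow> 'a"
  assumes "weakly_equicontinuous C T"
  shows "weakly_quasi_equicontinuous C T"
  unfolding weakly_quasi_equicontinuous_def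
proof (intro allI impI continuous_map_to_weak_topI)
  fix g :: "'a \<Rightarrow> 'a" and F :: "'s filter" and \<phi> :: "'a \<Rightarrow> real"
  assume gF: "F \<noteq> bot \<and> (\<forall>x\<in>C. limitin weak_top (\<lambda>s. T s x) (g x) F)" and \<phi>: "bounded_linear \<phi>"
  have lim: "((\<lambda>s. \<phi> (T s x)) \<longlongrightarrow> \<phi> (g x)) F" if "x \<in> C" for x
    using gF \<phi> that by (auto simp: limitin_weak_top)
  have "continuous_map (subtopology weak_top C) Met_TC.mtopology (\<lambda>x. \<phi> (g x))"
    unfolding Met_TC.continuous_map_to_metric
  proof (intro ballI allI impI)
    fix x and e :: real assume "x \<in> topspace (subtopology weak_top C)" "e > 0"
    then have x: "x \<in> C" and e: "e / 2 > 0" by auto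
    then obtain U where U: "openin (subtopology weak_top C) U" "x \<in> U"
      "\<And>y s. y \<in> U \<Longrightarrow> \<bar>\<phi> (T s y) - \<phi> (T s x)\<bar> < e / 2"
      using assms \<phi> unfolding weakly_equicontinuous_def by meson
    have "\<phi> (g y) \<in> Met_TC.mball (\<phi> (g x)) e" if "y \<in> U" for y
    proof -
      have "y \<in> C" using openin_subset[OF U(1)] that by auto
      have "\<bar>\<phi> (g y) - \<phi> (g x)\<bar> \<le> e / 2"
        using U(3)[OF that] gF
        by (intro tendsto_upperbound[OF tendsto_rabs[OF tendsto_diff[OF lim[OF \<open>y \<in> C\<close>] lim[OF x]]]])
          (auto intro: less_imp_le always_eventually)
      then show ?thesis using \<open>e > 0\<close> by (simp add: dist_real_def abs_minus_commute)
    qed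
    with U show "\<exists>U. openin (subtopology weak_top C) U \<and> x \<in> U \<and> (\<forall>y\<in>U. \<phi> (g y) \<in> Met_TC.mball (\<phi> (g x)) e)"
      by blast
  qed
  then show "continuous_map (subtopology weak_top C) euclideanreal (\<lambda>x. \<phi> (g x))" by simp
qed

lemma weakly_jointly_imp_separately_continuous:
  fixes T :: "'s::topological_space \<Rightarrow> 'a::real_normed_vector \<Rightarrow> 'a"
  assumes "weakly_jointly_continuous C T"
  shows "weakly_separately_continuous C T"
proof -
  let ?C = "subtopology weak_top C :: 'a topology"
  have T: "continuous_map (prod_topology euclidean ?C) ?C (\<lambda>(s, x). T s x)"
    using assms by (simp add: weakly_jointly_continuous_def)
  have "continuous_map ?C ?C (T s)" for s
  proof -
    have "continuous_map ?C (prod_topology euclidean ?C) (\<lambda>x. (s, x))"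
      by (intro continuous_map_pairedI) auto
    from continuous_map_compose[OF this T] show ?thesis by (simp add: o_def)
  qed
  moreover have "continuous_map euclidean ?C (\<lambda>s. T s x)" if "x \<in> C" for x
  proof -
    have "continuous_map euclidean (prod_topology euclidean ?C) (\<lambda>s. (s, x))"
      using that by (intro continuous_map_pairedI) auto
    from continuous_map_compose[OF this T] show ?thesis by (simp add: o_def)
  qed
  ultimately show ?thesis by (simp add: weakly_separately_continuous_def)
qed

section \<open>Functions along a bounded orbit of a weakly continuous action\<close>

locale weak_action =
  fixes C :: "'a::{real_inner, complete_space} set"
    and T :: "'s::{topological_space, semigroup_mult} \<Rightarrow> 'a \<Rightarrow> 'a" and c :: 'a
  assumes C_closed: "closed C" and C_convex: "convex C"
    and rep: "representation_on C T" and nonexp: "nonexpansive_on C T"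
    and c_in: "c \<in> C" and orbit_bdd: "bounded (range (\<lambda>s. T s c))"
    and separately: "weakly_separately_continuous C T"
begin

definition R :: real where "R = (SUP s. norm (T s c))"

text \<open>A weakly compact set containing the orbit of \<open>c\<close>. A map \<open>T s\<close>
  may lead out of \<open>K\<close> but stays in \<open>C\<close>, so functions to be composed with
  \<open>T s\<close> are taken continuous on \<open>C\<close>.\<close>

definition K :: "'a set" where "K = C \<inter> cball 0 R"

abbreviation "wC \<equiv> subtopology weak_top C"
abbreviation "wK \<equiv> subtopology weak_top K"

lemma norm_orbit: "norm (T s c) \<le> R"
proof -
  have "bounded (range (\<lambda>s. norm (T s c)))"
    using orbit_bdd by (simp add: bounded_norm_comp)
  then show ?thesis
    unfolding R_def by (intro cSUP_upper bounded_imp_bdd_above) auto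
qed

lemma T_in: "x \<in> C \<Longrightarrow> T s x \<in> C"
  using rep by (auto simp: representation_on_def)

lemma T_mult: "x \<in> C \<Longrightarrow> T (s * t) x = T s (T t x)"
  using rep by (auto simp: representation_on_def)

lemma K_subset: "K \<subseteq> C"
  by (simp add: K_def)

lemma orbit_in_K: "T s c \<in> K"
  using norm_orbit T_in c_in by (simp add: K_def)

text \<open>Nonexpansiveness carries boundedness from the orbit of \<open>c\<close> to every orbit,
  so weak ultralimits exist at all points of \<open>C\<close>.\<close>

lemma norm_T_le:
  assumes "x \<in> C" shows "norm (T s x) \<le> norm (x - c) + R"
proof -
  have "norm (T s x - T s c) \<le> norm (x - c)"
    using nonexp assms c_in by (auto simp: nonexpansive_on_def dist_norm)
  then show ?thesis
    using norm_orbit[of s] norm_triangle_sub[of "T s x" "T s c"] by linarith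
qed

lemma compact_ball: "compact_space (subtopology weak_top (C \<inter> cball 0 r))"
  using C_closed C_convex
  by (intro compact_space_weak_top_convex closed_Int convex_Int) (auto intro: bounded_subset[OF bounded_cball])

lemma compact_K: "compact_space wK"
  unfolding K_def by (rule compact_ball)

lemma cont_T: "continuous_map wC wC (T s)"
  using separately by (simp add: weakly_separately_continuous_def)

lemma cont_orbit: "continuous_map euclidean wK (\<lambda>s. T s c)"
  using separately c_in orbit_in_K
  by (auto simp: weakly_separately_continuous_def continuous_map_in_subtopology)

lemma cont_compose_T:
  "continuous_map wC euclideanreal f \<Longrightarrow> continuous_map wC euclideanreal (\<lambda>x. f (T s x))"
  using continuous_map_compose[OF cont_T] by (fastforce simp: o_def)

lemma cont_restrict: "continuous_map wC Y f \<Longrightarrow> continuous_map wK Y f"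
  using continuous_map_from_subtopology_mono K_subset by blast

definition along :: "('a \<Rightarrow> real) \<Rightarrow> 's \<Rightarrow> complex" where
  "along f = (\<lambda>t. complex_of_real (f (T t c)))"

lemma along_bcontfun:
  assumes "continuous_map wK euclideanreal f"
  shows "along f \<in> bcontfun"
proof -
  obtain k where k: "\<And>x. x \<in> topspace wK \<Longrightarrow> \<bar>f x\<bar> \<le> k"
    using compact_space_real_bounded[OF compact_K assms] by blast
  have "continuous_on UNIV (\<lambda>t. f (T t c))"
    using continuous_map_compose[OF cont_orbit assms] by (simp add: o_def)
  then show ?thesis
    unfolding along_def using k orbit_in_K
    by (intro bcontfun_normI[where b = k] continuous_on_of_real) auto
qed

lemma apply_along:
  "continuous_map wK euclideanreal f \<Longrightarrow> apply_bcontfun (Bcontfun (along f)) t = complex_of_real (f (T t c))"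
  by (simp add: Bcontfun_inverse along_bcontfun) (simp add: along_def)

lemma norm_along_diff_le:
  assumes "continuous_map wK euclideanreal f" "continuous_map wK euclideanreal g"
    and "\<And>x. x \<in> K \<Longrightarrow> \<bar>f x - g x\<bar> \<le> b"
  shows "norm (Bcontfun (along f) - Bcontfun (along g)) \<le> b"
  using assms(3)[OF orbit_in_K]
  by (intro norm_bound) (simp add: apply_along assms(1,2) flip: of_real_diff)

text \<open>Reduces compactness of the left orbit of \<open>along f\<close> to limits of the
  functions \<open>f (T s x)\<close> on \<open>K\<close>.\<close>

lemma lshift_along: "lshift s (along f) = along (\<lambda>x. f (T s x))"
  by (simp add: lshift_def along_def T_mult c_in)

lemma along_in_Cb: "continuous_map wC euclideanreal f \<Longrightarrow> along f \<in> Cb"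
  unfolding Cb_eq_bcontfun by (intro along_bcontfun cont_restrict)

lemma limitin_K:
  assumes "z \<in> K" "\<And>s. x s \<in> K" "limitin weak_top x z F"
  shows "limitin wC x z F"
  using assms K_subset by (auto simp: limitin_subtopology intro: always_eventually)

text \<open>Norm convergence follows from uniform convergence on \<open>K\<close>, which compactness
  reduces to convergence along moving points \<open>x s\<close> that tend weakly to some
  \<open>z\<close>.\<close>

lemma along_tendsto:
  assumes h: "\<And>s. continuous_map wK euclideanreal (h s)" and h0: "continuous_map wK euclideanreal h0"
    and lim: "\<And>U x z. ultra U \<Longrightarrow> U \<le> F \<Longrightarrow> (\<And>s. x s \<in> K) \<Longrightarrow> z \<in> K \<Longrightarrow> limitin wC x z U \<Longrightarrow>
                ((\<lambda>s. h s (x s) - h0 (x s)) \<longlongrightarrow> 0) U"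
  shows "((\<lambda>s. Bcontfun (along (h s))) \<longlongrightarrow> Bcontfun (along h0)) F"
proof (rule tendstoI)
  fix e :: real assume "e > 0"
  have "eventually (\<lambda>s. \<forall>x\<in>K. \<bar>h s x - h0 x\<bar> < e / 2) F"
  proof (rule ccontr)
    assume "\<not> ?thesis"
    then have "frequently (\<lambda>s. \<exists>x\<in>K. e / 2 \<le> \<bar>h s x - h0 x\<bar>) F"
      by (simp add: frequently_def not_le)
    then obtain U where U: "ultra U" "U \<le> F" "eventually (\<lambda>s. \<exists>x\<in>K. e / 2 \<le> \<bar>h s x - h0 x\<bar>) U"
      by (rule frequently_ultra)
    \<comment> \<open>Where there is no bad point, any point of \<open>K\<close> is taken, so that
      \<open>x\<close> is defined for every \<open>s\<close>.\<close>
    have "\<exists>y. y \<in> K \<and> ((\<exists>x\<in>K. e / 2 \<le> \<bar>h s x - h0 x\<bar>) \<longrightarrow> e / 2 \<le> \<bar>h s y - h0 y\<bar>)" for s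
      using orbit_in_K by blast
    then obtain x where x: "\<And>s. x s \<in> K"
      "\<And>s. (\<exists>x\<in>K. e / 2 \<le> \<bar>h s x - h0 x\<bar>) \<Longrightarrow> e / 2 \<le> \<bar>h s (x s) - h0 (x s)\<bar>"
      by metis
    obtain z where z: "z \<in> topspace wK" "limitin wK x z U"
      using compact_space_ultra_limit[OF compact_K U(1), of x] x(1) by auto
    then have "limitin wC x z U"
      using x(1) by (intro limitin_K) (auto simp: limitin_subtopology)
    then have "((\<lambda>s. h s (x s) - h0 (x s)) \<longlongrightarrow> 0) U"
      using lim[OF U(1,2)] x(1) z(1) by auto
    then have "eventually (\<lambda>s. \<bar>h s (x s) - h0 (x s)\<bar> < e / 2) U"
      using \<open>e > 0\<close> by (auto dest: tendstoD[where e = "e / 2"])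
    with U(3) have "eventually (\<lambda>s. False) U"
      by eventually_elim (use x(2) in force)
    then show False using ultra_not_bot[OF U(1)] by simp
  qed
  then show "eventually (\<lambda>s. dist (Bcontfun (along (h s))) (Bcontfun (along h0)) < e) F"
  proof eventually_elim
    case (elim s)
    then have "norm (Bcontfun (along (h s)) - Bcontfun (along h0)) \<le> e / 2"
      by (intro norm_along_diff_le h h0) (auto intro: less_imp_le)
    then show ?case using \<open>e > 0\<close> by (simp add: dist_norm)
  qed
qed

text \<open>Joint continuity at \<open>(s0, z)\<close> allows the point to move with
  \<open>s\<close>: both \<open>f (T s (x s))\<close> and \<open>f (T s0 (x s))\<close> tend to
  \<open>f (T s0 z)\<close>.\<close>

lemma along_in_LUC:
  assumes joint: "weakly_jointly_continuous C T" and f: "continuous_map wC euclideanreal f"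
  shows "along f \<in> LUC"
proof -
  have "((\<lambda>s. Bcontfun (along (\<lambda>x. f (T s x)))) \<longlongrightarrow> Bcontfun (along (\<lambda>x. f (T s0 x)))) (at s0)" for s0
  proof (intro along_tendsto cont_restrict cont_compose_T f)
    fix U x z assume U: "U \<le> at s0" and x: "limitin wC x z U"
    have "(id \<longlongrightarrow> s0) U"
      using tendsto_mono[OF U tendsto_ident_at] by (simp add: id_def)
    then have "limitin (prod_topology euclidean wC) (\<lambda>s. (s, x s)) (s0, z) U"
      using x by (simp add: limitin_pairwise o_def id_def)
    from continuous_map_limit[OF _ this] have "limitin wC (\<lambda>s. T s (x s)) (T s0 z) U"
      using joint by (fastforce simp: weakly_jointly_continuous_def o_def)
    then have "((\<lambda>s. f (T s (x s))) \<longlongrightarrow> f (T s0 z)) U"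
      by (rule continuous_map_real_limit[OF f])
    moreover have "((\<lambda>s. f (T s0 (x s))) \<longlongrightarrow> f (T s0 z)) U"
      by (rule continuous_map_real_limit[OF cont_compose_T[OF f] x])
    ultimately show "((\<lambda>s. f (T s (x s)) - f (T s0 (x s))) \<longlongrightarrow> 0) U"
      using tendsto_diff by fastforce
  qed
  then show ?thesis
    using along_in_Cb[OF f] by (simp add: LUC_def lshift_along continuous_on_def)
qed

lemma ultra_pointwise_limit:
  assumes U: "ultra U"
  obtains g where "\<And>x. x \<in> C \<Longrightarrow> limitin weak_top (\<lambda>s. T s x) (g x) U" "\<And>x. x \<in> C \<Longrightarrow> g x \<in> C"
proof -
  have "\<exists>l. limitin weak_top (\<lambda>s. T s x) l U \<and> l \<in> C" if x: "x \<in> C" for x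
  proof -
    have "eventually (\<lambda>s. norm (T s x) \<le> norm (x - c) + R) U"
      using norm_T_le[OF x] by (simp add: always_eventually)
    from bounded_ultra_weak_limit[OF U this] obtain l where l: "limitin weak_top (\<lambda>s. T s x) l U"
      by blast
    then have "l \<in> C"
      using C_closed C_convex T_in[OF x] U by (intro convex_weak_limit_mem[OF _ _ l]) (auto simp: ultra_not_bot)
    with l show ?thesis by blast
  qed
  then obtain g where "\<And>x. x \<in> C \<Longrightarrow> limitin weak_top (\<lambda>s. T s x) (g x) U \<and> g x \<in> C" by metis
  with that show thesis by blast
qed

lemma ultra_pointwise_limit_cont:
  assumes quasi: "weakly_quasi_equicontinuous C T" and U: "ultra U"
  obtains g where "\<And>x. x \<in> C \<Longrightarrow> limitin wC (\<lambda>s. T s x) (g x) U" "continuous_map wC wC g"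
proof -
  obtain g where g: "\<And>x. x \<in> C \<Longrightarrow> limitin weak_top (\<lambda>s. T s x) (g x) U" "\<And>x. x \<in> C \<Longrightarrow> g x \<in> C"
    using ultra_pointwise_limit[OF U] by blast
  have "continuous_map wC weak_top g"
    using quasi g(1) ultra_not_bot[OF U] unfolding weakly_quasi_equicontinuous_def by blast
  then have "continuous_map wC wC g"
    using g(2) by (auto simp: continuous_map_in_subtopology)
  moreover have "limitin wC (\<lambda>s. T s x) (g x) U" if "x \<in> C" for x
    using g that T_in by (auto simp: limitin_subtopology)
  ultimately show thesis using that by blast
qed

text \<open>Along an ultrafilter the left orbit converges in norm to
  \<open>along (\<lambda>x. f (g x))\<close>, where \<open>g\<close> is the pointwise weak limit of
  the maps \<open>T s\<close>.\<close>

lemma along_in_AP: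
  assumes equi: "weakly_equicontinuous C T" and f: "continuous_map wC euclideanreal f"
  shows "along f \<in> AP"
proof -
  have "\<exists>l. limitin euclidean (\<lambda>s. Bcontfun (along (\<lambda>x. f (T s x)))) l U" if U: "ultra U" for U
  proof -
    obtain g where g: "\<And>x. x \<in> C \<Longrightarrow> limitin wC (\<lambda>s. T s x) (g x) U" "continuous_map wC wC g"
      using ultra_pointwise_limit_cont[OF weakly_equicontinuous_imp_quasi[OF equi] U] by blast
    have fg: "continuous_map wC euclideanreal (\<lambda>x. f (g x))"
      using continuous_map_compose[OF g(2) f] by (simp add: o_def)
    have "((\<lambda>s. Bcontfun (along (\<lambda>x. f (T s x)))) \<longlongrightarrow> Bcontfun (along (\<lambda>x. f (g x)))) U"
    proof (intro along_tendsto cont_restrict cont_compose_T f fg)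
      fix V x z assume V: "V \<le> U" and x: "\<And>s. x s \<in> K" "z \<in> K" "limitin wC x z V"
      have zC: "z \<in> C" and xC: "\<And>s. x s \<in> C" using x K_subset by auto
      have "limitin weak_top (\<lambda>s. T s (x s)) (g z) V"
        unfolding limitin_weak_top
      proof (intro allI impI)
        fix \<phi> :: "'a \<Rightarrow> real" assume \<phi>: "bounded_linear \<phi>"
        have "((\<lambda>s. \<phi> (T s z)) \<longlongrightarrow> \<phi> (g z)) U"
          using g(1)[OF zC] \<phi> by (auto simp: limitin_subtopology limitin_weak_top)
        then have "((\<lambda>s. \<phi> (T s z)) \<longlongrightarrow> \<phi> (g z)) V"
          by (rule tendsto_mono[OF V])
        \<comment> \<open>Equicontinuity at \<open>z\<close> controls the difference uniformly in
          \<open>s\<close>, so the moving point may be replaced by \<open>z\<close>.\<close>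
        moreover have "((\<lambda>s. \<phi> (T s (x s)) - \<phi> (T s z)) \<longlongrightarrow> 0) V"
        proof (rule tendstoI)
          fix e :: real assume "e > 0"
          then obtain W where "openin wC W" "z \<in> W" "\<forall>y\<in>W. \<forall>s. \<bar>\<phi> (T s y) - \<phi> (T s z)\<bar> < e"
            using equi zC \<phi> unfolding weakly_equicontinuous_def by meson
          then show "eventually (\<lambda>s. dist (\<phi> (T s (x s)) - \<phi> (T s z)) 0 < e) V"
            by (intro eventually_mono[OF limitinD[OF x(3)]]) auto
        qed
        ultimately show "((\<lambda>s. \<phi> (T s (x s))) \<longlongrightarrow> \<phi> (g z)) V"
          using tendsto_add by fastforce
      qed
      then have "limitin wC (\<lambda>s. T s (x s)) (g z) V"
        using xC T_in g(1)[OF zC] by (auto simp: limitin_subtopology)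
      then have "((\<lambda>s. f (T s (x s))) \<longlongrightarrow> f (g z)) V"
        by (rule continuous_map_real_limit[OF f])
      moreover have "((\<lambda>s. f (g (x s))) \<longlongrightarrow> f (g z)) V"
        by (rule continuous_map_real_limit[OF fg x(3)])
      ultimately show "((\<lambda>s. f (T s (x s)) - f (g (x s))) \<longlongrightarrow> 0) V"
        using tendsto_diff by fastforce
    qed
    then show ?thesis by (auto simp: limitin_canonical_iff)
  qed
  then have "compactin euclidean (euclidean closure_of range (\<lambda>s. Bcontfun (along (\<lambda>x. f (T s x)))))"
    by (intro compactin_closure_of_range_ultraI regular_space_euclidean) auto
  then show ?thesis
    using along_in_Cb[OF f] by (simp add: AP_def lshift_along)
qed

text \<open>Pulls a functional on bounded continuous functions on the semigroup back to C(K), where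
  dominated convergence is available; \<open>along\<close> is contractive, so the bound
  survives.\<close>

lemma bounded_functional_along:
  fixes \<phi> :: "('s \<Rightarrow>\<^sub>C complex) \<Rightarrow> real"
  assumes "bounded_linear \<phi>"
  obtains B where "bounded_functional wK (\<lambda>f. \<phi> (Bcontfun (along f))) B"
proof -
  interpret \<phi>: bounded_linear \<phi> by fact
  obtain B where B: "B \<ge> 0" "\<And>u. \<bar>\<phi> u\<bar> \<le> B * norm u"
    using \<phi>.nonneg_bounded by (auto simp: mult.commute)
  have "bounded_functional wK (\<lambda>f. \<phi> (Bcontfun (along f))) B"
  proof
    fix f g :: "'a \<Rightarrow> real"
    assume fg: "continuous_map wK euclideanreal f" "continuous_map wK euclideanreal g"
    then have "Bcontfun (along (\<lambda>x. f x + g x)) = Bcontfun (along f) + Bcontfun (along g)"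
      by (intro bcontfun_eqI) (simp add: apply_along continuous_map_add)
    then show "\<phi> (Bcontfun (along (\<lambda>x. f x + g x))) = \<phi> (Bcontfun (along f)) + \<phi> (Bcontfun (along g))"
      by (simp add: \<phi>.add)
  next
    fix f k assume f: "continuous_map wK euclideanreal f" "\<And>x. x \<in> topspace wK \<Longrightarrow> \<bar>f x\<bar> \<le> k" "0 \<le> k"
    have "norm (Bcontfun (along f)) \<le> k"
      using f(1,2) orbit_in_K by (intro norm_bound) (simp add: apply_along)
    then show "\<bar>\<phi> (Bcontfun (along f))\<bar> \<le> B * k"
      using B(2)[of "Bcontfun (along f)"] mult_left_mono[OF _ B(1)] order_trans by blast
  qed (use compact_K B(1) in auto)
  then show thesis by (rule that)
qed

text \<open>Quasi-equicontinuity makes the pointwise limits continuous on \<open>K\<close>, and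
  \<open>pointwise_ultralimit\<close> upgrades pointwise convergence to convergence under every
  functional.\<close>

lemma along_in_WAP:
  assumes quasi: "weakly_quasi_equicontinuous C T" and f: "continuous_map wC euclideanreal f"
  shows "along f \<in> WAP"
proof -
  have "\<exists>l. limitin weak_top (\<lambda>s. Bcontfun (along (\<lambda>x. f (T s x)))) l U" if U: "ultra U" for U
  proof -
    obtain g where g: "\<And>x. x \<in> C \<Longrightarrow> limitin wC (\<lambda>s. T s x) (g x) U" "continuous_map wC wC g"
      using ultra_pointwise_limit_cont[OF quasi U] by blast
    have "limitin weak_top (\<lambda>s. Bcontfun (along (\<lambda>x. f (T s x)))) (Bcontfun (along (\<lambda>x. f (g x)))) U"
      unfolding limitin_weak_top
    proof (intro allI impI)
      fix \<phi> :: "('s \<Rightarrow>\<^sub>C complex) \<Rightarrow> real" assume "bounded_linear \<phi>"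
      then obtain B where "bounded_functional wK (\<lambda>f. \<phi> (Bcontfun (along f))) B"
        using bounded_functional_along by blast
      then interpret bounded_functional wK "\<lambda>f. \<phi> (Bcontfun (along f))" B .
      \<comment> \<open>Bounds the norm of \<open>T s x\<close> for all \<open>s\<close> and all
        \<open>x\<close> in \<open>K\<close>, so that \<open>f\<close> is bounded on a weakly
        compact set containing these points.\<close>
      define r where "r = R + norm c + R"
      obtain k where k: "\<And>x. x \<in> topspace (subtopology weak_top (C \<inter> cball 0 r)) \<Longrightarrow> \<bar>f x\<bar> \<le> k"
        using compact_space_real_bounded[OF compact_ball[of r]]
          continuous_map_from_subtopology_mono[OF f, of "C \<inter> cball 0 r"] by blast
      show "((\<lambda>s. \<phi> (Bcontfun (along (\<lambda>x. f (T s x))))) \<longlongrightarrow> \<phi> (Bcontfun (along (\<lambda>x. f (g x))))) U"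
      proof (rule pointwise_ultralimit[OF _ _ _ U])
        show "continuous_map wK euclideanreal (\<lambda>x. f (T s x))" for s
          by (intro cont_restrict cont_compose_T f)
        show "\<bar>f (T s x)\<bar> \<le> k" if "x \<in> topspace wK" for s x
        proof -
          have x: "x \<in> C" "norm x \<le> R" using that by (auto simp: K_def)
          then have "norm (T s x) \<le> r"
            using norm_T_le[OF x(1), of s] norm_triangle_ineq4[of x c] by (simp add: r_def)
          then show ?thesis using k T_in[OF x(1)] by simp
        qed
        show "((\<lambda>s. f (T s x)) \<longlongrightarrow> f (g x)) U" if "x \<in> topspace wK" for x
          using continuous_map_real_limit[OF f g(1)] that K_subset by auto
        \<comment> \<open>Every pointwise ultralimit \<open>h\<close> agrees on \<open>K\<close>
          with \<open>f\<close> composed with a weakly continuous limit map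
          \<open>g'\<close>.\<close>
        fix V h assume V: "ultra V" and h: "\<And>x. x \<in> topspace wK \<Longrightarrow> ((\<lambda>s. f (T s x)) \<longlongrightarrow> h x) V"
        obtain g' where g': "\<And>x. x \<in> C \<Longrightarrow> limitin wC (\<lambda>s. T s x) (g' x) V" "continuous_map wC wC g'"
          using ultra_pointwise_limit_cont[OF quasi V] by blast
        have "continuous_map wK euclideanreal (\<lambda>x. f (g' x))"
          using continuous_map_compose[OF g'(2) f] by (intro cont_restrict) (simp add: o_def)
        moreover have "f (g' x) = h x" if "x \<in> topspace wK" for x
          using tendsto_unique[OF ultra_not_bot[OF V] continuous_map_real_limit[OF f g'(1)] h[OF that]]
            that K_subset by auto
        ultimately show "continuous_map wK euclideanreal h"
          by (rule continuous_map_eq)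
      qed
    qed
    then show ?thesis by blast
  qed
  then have "compactin weak_top (weak_top closure_of range (\<lambda>s. Bcontfun (along (\<lambda>x. f (T s x)))))"
    by (intro compactin_closure_of_range_ultraI regular_space_weak_top) auto
  then show ?thesis
    using along_in_Cb[OF f] by (simp add: WAP_def lshift_along)
qed

text \<open>The functions along the orbit that come from weakly continuous functions on
  \<open>C\<close> are stable under left translation, because each \<open>T t\<close> is weakly
  continuous on \<open>C\<close>.\<close>

lemma fixed_point:
  assumes X: "X \<subseteq> Cb" "has_LIM X"
    and along_in: "\<And>f. continuous_map wC euclideanreal f \<Longrightarrow> along f \<in> X"
  shows "\<exists>x\<in>C. \<forall>s. T s x = x"
proof -
  define L where "L = {\<lambda>s. f (T s c) | f. continuous_map wC euclideanreal f}"
  have LI: "(\<lambda>s. f (T s c)) \<in> L" if "continuous_map wC euclideanreal f" for f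
    using that by (auto simp: L_def)
  show ?thesis
  proof (rule fixed_point_of_left_invariant_mean[OF C_closed C_convex rep nonexp c_in orbit_bdd X, of L])
    show "(\<lambda>s. complex_of_real (f s)) \<in> X" if "f \<in> L" for f
      using that along_in by (auto simp: L_def along_def)
    show "(\<lambda>s. a) \<in> L" for a
      using LI[of "\<lambda>x. a"] by simp
    show "(\<lambda>s. f s + g s) \<in> L" if fg: "f \<in> L" "g \<in> L" for f g
    proof -
      obtain f' g' where "continuous_map wC euclideanreal f'" "continuous_map wC euclideanreal g'"
        "f = (\<lambda>s. f' (T s c))" "g = (\<lambda>s. g' (T s c))"
        using fg unfolding L_def by blast
      then show ?thesis using LI[OF continuous_map_add] by simp
    qed
    show "(\<lambda>s. f (t * s)) \<in> L" if f: "f \<in> L" for f t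
    proof -
      obtain f' where "continuous_map wC euclideanreal f'" "f = (\<lambda>s. f' (T s c))"
        using f unfolding L_def by blast
      then show ?thesis using LI[OF cont_compose_T, of f' t] by (simp add: T_mult c_in)
    qed
    show "(\<lambda>s. T s c \<bullet> y) \<in> L" for y
      by (intro LI continuous_map_from_subtopology continuous_map_weak_top_functional bounded_linear_inner_left)
  qed
qed

end

theorem theorem4p3:
  fixes C :: "'a::{real_inner, complete_space} set"
    and T :: "'s::{t2_space, semigroup_mult} \<Rightarrow> 'a \<Rightarrow> 'a"
    and c :: 'a
  assumes semitop_left: "\<And>t. continuous_on UNIV (\<lambda>s::'s. t * s)"
    and semitop_right: "\<And>t. continuous_on UNIV (\<lambda>s::'s. s * t)"
    and C_ne: "C \<noteq> {}" and C_closed: "closed C" and C_convex: "convex C"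
    and rep: "representation_on C T"
    and nonexp: "nonexpansive_on C T"
    and c_in: "c \<in> C"
    and orbit_bdd: "bounded (range (\<lambda>s. T s c))"
    and cases:
      "(has_LIM (Cb :: ('s \<Rightarrow> complex) set) \<and>
          continuous_map euclidean (subtopology weak_top C) (\<lambda>s. T s c))
       \<or> (left_amenable TYPE('s) \<and> weakly_jointly_continuous C T)
       \<or> (has_LIM (AP :: ('s \<Rightarrow> complex) set) \<and> weakly_separately_continuous C T
            \<and> weakly_equicontinuous C T)
       \<or> (has_LIM (WAP :: ('s \<Rightarrow> complex) set) \<and> weakly_separately_continuous C T
            \<and> weakly_quasi_equicontinuous C T)"
  shows "\<exists>x\<in>C. \<forall>s. T s x = x"
  using cases
proof (elim disjE conjE)
  assume lim: "has_LIM (Cb :: ('s \<Rightarrow> complex) set)"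
    and cont: "continuous_map euclidean (subtopology weak_top C) (\<lambda>s. T s c)"
  \<comment> \<open>Here weak continuity is given for the orbit map of \<open>c\<close> alone, so
    \<open>L\<close> consists of all bounded continuous real functions; \<open>semitop_left\<close>
    makes it stable under left translation.\<close>
  define L :: "('s \<Rightarrow> real) set" where "L = bcontfun"
  show ?thesis
  proof (rule fixed_point_of_left_invariant_mean[OF C_closed C_convex rep nonexp c_in orbit_bdd order_refl lim, of L])
    show "(\<lambda>s. complex_of_real (f s)) \<in> Cb" if "f \<in> L" for f
      using that by (auto simp: L_def Cb_def bcontfun_def bounded_iff intro!: continuous_on_of_real)
    show "(\<lambda>s. a) \<in> L" for a
      unfolding L_def by (rule const_bcontfun)
    show "(\<lambda>s. f s + g s) \<in> L" if "f \<in> L" "g \<in> L" for f g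
      using that unfolding L_def by (rule plus_cont)
    show "(\<lambda>s. f (t * s)) \<in> L" if "f \<in> L" for f t
      using that continuous_on_compose2[OF _ semitop_left[of t]]
      by (auto simp: L_def bcontfun_def bounded_iff)
    show "(\<lambda>s. T s c \<bullet> y) \<in> L" for y
    proof -
      obtain R where R: "\<And>s. norm (T s c) \<le> R"
        using orbit_bdd by (auto simp: bounded_iff)
      have "continuous_map (subtopology weak_top C) euclideanreal (\<lambda>x. x \<bullet> y)"
        by (intro continuous_map_from_subtopology continuous_map_weak_top_functional bounded_linear_inner_left)
      from continuous_map_compose[OF cont this] have "continuous_on UNIV (\<lambda>s. T s c \<bullet> y)"
        by (simp add: o_def)
      moreover have "norm (T s c \<bullet> y) \<le> R * norm y" for s
        using order_trans[OF Cauchy_Schwarz_ineq2 mult_right_mono[OF R norm_ge_zero]] by simp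
      ultimately show ?thesis
        unfolding L_def by (rule bcontfun_normI)
    qed
  qed
next
  assume lim: "left_amenable TYPE('s)" and joint: "weakly_jointly_continuous C T"
  then interpret weak_action C T c
    using C_closed C_convex rep nonexp c_in orbit_bdd weakly_jointly_imp_separately_continuous
    by unfold_locales
  show ?thesis
    using lim along_in_LUC[OF joint] by (intro fixed_point[of LUC]) (auto simp: left_amenable_def LUC_def)
next
  assume lim: "has_LIM (AP :: ('s \<Rightarrow> complex) set)" and sep: "weakly_separately_continuous C T"
    and equi: "weakly_equicontinuous C T"
  interpret weak_action C T c
    using C_closed C_convex rep nonexp c_in orbit_bdd sep by unfold_locales
  show ?thesis
    using lim along_in_AP[OF equi] by (intro fixed_point[of AP]) (auto simp: AP_def)
next
  assume lim: "has_LIM (WAP :: ('s \<Rightarrow> complex) set)" and sep: "weakly_separately_continuous C T"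
    and quasi: "weakly_quasi_equicontinuous C T"
  interpret weak_action C T c
    using C_closed C_convex rep nonexp c_in orbit_bdd sep by unfold_locales
  show ?thesis
    using lim along_in_WAP[OF quasi] by (intro fixed_point[of WAP]) (auto simp: WAP_def)
qed

end
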